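(* Let $\mathbf{k}$ be a unitary commutative ring and let $H_{LR}$ be the classical Loday-Ronco Hopf algebra of (undecorated) planar binary trees over $\mathbf{k}$, equipped with the grafting operation $\vee$. (a) $H_{LR}$ is the free cocycle $\vee$-bialgebra on the empty set, that is, the initial object in the category of cocycle $\vee$-bialgebras. (b) $H_{LR}$ is the free cocycle $\vee$-Hopf algebra on the empty set, that is, the initial object in the category of cocycle $\vee$-Hopf algebras.
   Context: All modules, algebras, coalgebras, bialgebras, Hopf algebras, linear maps and tensor products are over $\mathbf{k}$; algebras are associative and unitary but not necessarily commutative. The Hopf algebra $H_{LR}$. For $n\ge0$, $Y_n$ is the set of planar binary rooted trees with $n$ interior vertices (each interior vertex has exactly a left and a right child); $Y_0=\{|\}$, where $|$ is the tree with one leaf and no interior vertex. $H_{LR}$ is the free $\mathbf{k}$-module on $\bigsqcup_{n\ge0}Y_n$. For trees $T_1,T_2$, the grafting $T_1\vee T_2$ is the tree whose root vertex has left subtree $T_1$ and right subtree $T_2$; $\vee$ is extended to a linear map $H_{LR}\otimes H_{LR}\to H_{LR}$. Every tree $T\ne|$ is uniquely $T=T^l\vee T^r$. The product $\ast$, with unit $|$, is bilinear and defined recursively by $|\ast T=T\ast|=T$ and, for $T=T^l\vee T^r$, $T'=T'^l\vee T'^r$, $T\ast T'=T^l\vee(T^r\ast T')+(T\ast T'^l)\vee T'^r$. The coproduct $\Delta$ is linear and defined recursively by $\Delta(|)=|\otimes|$ and $\Delta(T^l\vee T^r)=(T^l\vee T^r)\otimes|+(\ast,\vee)\bigl(\Delta(T^l)\otimes\Delta(T^r)\bigr)$,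 where $(\ast,\vee)=(\ast\otimes\vee)\circ\tau_{23}$ and $\tau_{23}$ exchanges the second and third tensor factors. The counit is the linear map with $|\mapsto1_{\mathbf{k}}$ and $T\mapsto0$ for trees $T\ne|$. A $\vee$-algebra is an algebra $(A,\ast_A,1_A)$ with a binary operation (linear map) $\vee:A\otimes A\to A$ such that for $a=a_1\vee a_2$ and $a'=a_1'\vee a_2'$ (with $a_1,a_2,a_1',a_2'\in A$), $a\ast_A a'=a_1\vee(a_2\ast_A a')+(a\ast_A a_1')\vee a_2'$. A $\vee$-bialgebra (resp. $\vee$-Hopf algebra) is a bialgebra (resp. Hopf algebra) $(H,\ast_H,1_H,\Delta_H,\varepsilon_H)$ which is also a $\vee$-algebra $(H,\ast_H,1_H,\vee)$. It is called cocycle if for all $h,h'\in H$, $\Delta_H(h\vee h')=(h\vee h')\otimes1_H+(\ast_H,\vee)\bigl(\Delta_H(h)\otimes\Delta_H(h')\bigr)$, where $(\ast_H,\vee)=(\ast_H\otimes\vee)\circ\tau_{23}$. A $\vee$-bialgebra (resp. $\vee$-Hopf algebra) morphism $\phi:(H,\vee)\to(H',\vee')$ is a bialgebra (resp. Hopf algebra) morphism with $\phi\circ\vee=\vee'\circ(\phi\otimes\phi)$; these are the morphisms in the respective categories. A free cocycle $\vee$-bialgebra (resp. Hopf algebra) on a set $X$ is a cocycle $\vee$-bialgebra (resp. Hopf algebra) $H$ with a set map $j:X\to H$ such that for every cocycle $\vee$-bialgebra (resp. Hopf algebra) $H'$ and set map $\phi:X\to H'$ there is a unique $\vee$-bialgebra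 (resp. Hopf algebra) morphism $\bar\phi:H\to H'$ with $\bar\phi\circ j=\phi$. *)

theory Defs
  imports "HOL-Algebra.Module" "HOL-Algebra.AbelCoset"
begin

section \<open>Modules, free modules and tensor products over a commutative ring\<close>

text \<open>
  Modules are records of type \<^typ>\<open>('k, 'a) module\<close>.  That record type also has
  multiplicative fields \<open>mult\<close> and \<open>one\<close>; they carry no meaning for objects which are only modules,
  such as free modules and tensor products, and are left unspecified there.
\<close>

definition module_hom ::
  "('k, 'm) ring_scheme \<Rightarrow> ('k, 'a, 'p) module_scheme \<Rightarrow> ('k, 'b, 'q) module_scheme \<Rightarrow> ('a \<Rightarrow> 'b) set"
  where
  "module_hom R M N =
     {f. f \<in> carrier M \<rightarrow> carrier N \<and>
         (\<forall>x\<in>carrier M. \<forall>y\<in>carrier M. f (x \<oplus>\<^bsub>M\<^esub> y) = f x \<oplus>\<^bsub>N\<^esub> f y) \<and>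
         (\<forall>r\<in>carrier R. \<forall>x\<in>carrier M. f (r \<odot>\<^bsub>M\<^esub> x) = r \<odot>\<^bsub>N\<^esub> f x)}"

definition bilinear_map ::
  "('k, 'm) ring_scheme \<Rightarrow> ('k, 'a, 'p) module_scheme \<Rightarrow> ('k, 'b, 'q) module_scheme
     \<Rightarrow> ('k, 'c, 'r) module_scheme \<Rightarrow> ('a \<Rightarrow> 'b \<Rightarrow> 'c) \<Rightarrow> bool"
  where
  "bilinear_map R M N P \<beta> \<longleftrightarrow>
     (\<forall>a\<in>carrier M. (\<lambda>b. \<beta> a b) \<in> module_hom R N P) \<and>
     (\<forall>b\<in>carrier N. (\<lambda>a. \<beta> a b) \<in> module_hom R M P)"

definition regular_module :: "('k, 'm) ring_scheme \<Rightarrow> ('k, 'k) module" where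
  "regular_module R =
     \<lparr>carrier = carrier R, monoid.mult = monoid.mult R, monoid.one = \<one>\<^bsub>R\<^esub>, ring.zero = \<zero>\<^bsub>R\<^esub>, ring.add = ring.add R,
      smult = monoid.mult R\<rparr>"

definition free_module :: "('k, 'm) ring_scheme \<Rightarrow> 's set \<Rightarrow> ('k, 's \<Rightarrow> 'k) module" where
  "free_module R S =
     \<lparr>carrier = {f. (\<forall>s. f s \<in> carrier R) \<and> (\<forall>s. s \<notin> S \<longrightarrow> f s = \<zero>\<^bsub>R\<^esub>) \<and> finite {s. f s \<noteq> \<zero>\<^bsub>R\<^esub>}},
      monoid.mult = undefined, monoid.one = undefined,
      ring.zero = (\<lambda>s. \<zero>\<^bsub>R\<^esub>), ring.add = (\<lambda>f g s. f s \<oplus>\<^bsub>R\<^esub> g s),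
      smult = (\<lambda>r f s. r \<otimes>\<^bsub>R\<^esub> f s)\<rparr>"

definition basis_elt :: "('k, 'm) ring_scheme \<Rightarrow> 's \<Rightarrow> ('s \<Rightarrow> 'k)" where
  "basis_elt R s = (\<lambda>t. if t = s then \<one>\<^bsub>R\<^esub> else \<zero>\<^bsub>R\<^esub>)"

text \<open>The linear extension to a free module of the map \<open>g\<close> given on its basis.\<close>

definition lin_ext ::
  "('k, 'm) ring_scheme \<Rightarrow> ('k, 'a, 'p) module_scheme \<Rightarrow> ('s \<Rightarrow> 'a) \<Rightarrow> ('s \<Rightarrow> 'k) \<Rightarrow> 'a" where
  "lin_ext R P g f = (\<Oplus>\<^bsub>P\<^esub>s\<in>{s. f s \<noteq> \<zero>\<^bsub>R\<^esub>}. f s \<odot>\<^bsub>P\<^esub> g s)"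

definition bilin_ext ::
  "('k, 'm) ring_scheme \<Rightarrow> ('k, 'a, 'p) module_scheme \<Rightarrow> ('s \<Rightarrow> 't \<Rightarrow> 'a)
     \<Rightarrow> ('s \<Rightarrow> 'k) \<Rightarrow> ('t \<Rightarrow> 'k) \<Rightarrow> 'a" where
  "bilin_ext R P g x y = lin_ext R P (\<lambda>s. lin_ext R P (\<lambda>t. g s t) y) x"

text \<open>
  The tensor product of \<open>M\<close> and \<open>N\<close> is the quotient of the free module on
  \<open>carrier M \<times> carrier N\<close> by the submodule \<open>tensor_ker\<close> generated by the bilinearity relations;
  its elements are cosets.
\<close>

definition tensor_rels ::
  "('k, 'm) ring_scheme \<Rightarrow> ('k, 'a, 'p) module_scheme \<Rightarrow> ('k, 'b, 'q) module_scheme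
     \<Rightarrow> ('a \<times> 'b \<Rightarrow> 'k) set" where
  "tensor_rels R M N =
     (let F = free_module R (carrier M \<times> carrier N); e = (\<lambda>a b. basis_elt R (a, b)) in
        {e (a \<oplus>\<^bsub>M\<^esub> a') b \<ominus>\<^bsub>F\<^esub> (e a b \<oplus>\<^bsub>F\<^esub> e a' b) | a a' b.
           a \<in> carrier M \<and> a' \<in> carrier M \<and> b \<in> carrier N}
      \<union> {e a (b \<oplus>\<^bsub>N\<^esub> b') \<ominus>\<^bsub>F\<^esub> (e a b \<oplus>\<^bsub>F\<^esub> e a b') | a b b'.
           a \<in> carrier M \<and> b \<in> carrier N \<and> b' \<in> carrier N}
      \<union> {e (r \<odot>\<^bsub>M\<^esub> a) b \<ominus>\<^bsub>F\<^esub> r \<odot>\<^bsub>F\<^esub> e a b | r a b.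
           r \<in> carrier R \<and> a \<in> carrier M \<and> b \<in> carrier N}
      \<union> {e a (r \<odot>\<^bsub>N\<^esub> b) \<ominus>\<^bsub>F\<^esub> r \<odot>\<^bsub>F\<^esub> e a b | r a b.
           r \<in> carrier R \<and> a \<in> carrier M \<and> b \<in> carrier N})"

definition tensor_ker ::
  "('k, 'm) ring_scheme \<Rightarrow> ('k, 'a, 'p) module_scheme \<Rightarrow> ('k, 'b, 'q) module_scheme
     \<Rightarrow> ('a \<times> 'b \<Rightarrow> 'k) set" where
  "tensor_ker R M N =
     \<Inter>{K. submodule K R (free_module R (carrier M \<times> carrier N)) \<and> tensor_rels R M N \<subseteq> K}"

definition tensor ::
  "('k, 'm) ring_scheme \<Rightarrow> ('k, 'a, 'p) module_scheme \<Rightarrow> ('k, 'b, 'q) module_scheme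
     \<Rightarrow> ('k, ('a \<times> 'b \<Rightarrow> 'k) set) module" where
  "tensor R M N =
     (let F = free_module R (carrier M \<times> carrier N); K = tensor_ker R M N in
        \<lparr>carrier = a_rcosets\<^bsub>F\<^esub> K,
         monoid.mult = undefined, monoid.one = undefined,
         ring.zero = K, ring.add = (\<lambda>X Y. X <+>\<^bsub>F\<^esub> Y),
         smult = (\<lambda>r X. \<Union>f\<in>X. K +>\<^bsub>F\<^esub> (r \<odot>\<^bsub>F\<^esub> f))\<rparr>)"

definition tens ::
  "('k, 'm) ring_scheme \<Rightarrow> ('k, 'a, 'p) module_scheme \<Rightarrow> ('k, 'b, 'q) module_scheme
     \<Rightarrow> 'a \<Rightarrow> 'b \<Rightarrow> ('a \<times> 'b \<Rightarrow> 'k) set" where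
  "tens R M N a b =
     tensor_ker R M N +>\<^bsub>free_module R (carrier M \<times> carrier N)\<^esub> basis_elt R (a, b)"

text \<open>
  The linear map out of the tensor product induced by a bilinear map \<open>\<beta>\<close> with values in \<open>P\<close>: all
  representatives of a coset \<open>X\<close> have the same image under the linear extension of \<open>\<beta>\<close>.
\<close>

definition tensor_lift ::
  "('k, 'm) ring_scheme \<Rightarrow> ('k, 'c, 'r) module_scheme \<Rightarrow> ('a \<Rightarrow> 'b \<Rightarrow> 'c)
     \<Rightarrow> ('a \<times> 'b \<Rightarrow> 'k) set \<Rightarrow> 'c" where
  "tensor_lift R P \<beta> X = the_elem (lin_ext R P (\<lambda>(a, b). \<beta> a b) ` X)"

definition tensor_map ::
  "('k, 'm) ring_scheme \<Rightarrow> ('k, 'c, 'r) module_scheme \<Rightarrow> ('k, 'd, 's) module_scheme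
     \<Rightarrow> ('a \<Rightarrow> 'c) \<Rightarrow> ('b \<Rightarrow> 'd) \<Rightarrow> ('a \<times> 'b \<Rightarrow> 'k) set \<Rightarrow> ('c \<times> 'd \<Rightarrow> 'k) set" where
  "tensor_map R M' N' f g = tensor_lift R (tensor R M' N') (\<lambda>a b. tens R M' N' (f a) (g b))"

text \<open>The canonical map from \<open>(L \<otimes> M) \<otimes> N\<close> to \<open>L \<otimes> (M \<otimes> N)\<close>.\<close>

definition tensor_assoc where
  "tensor_assoc R L M N =
     (let T = tensor R L (tensor R M N) in
        tensor_lift R T
          (\<lambda>x c. tensor_lift R T (\<lambda>a b. tens R L (tensor R M N) a (tens R M N b c)) x))"

text \<open>
  The exchange of the two inner factors, for four copies of \<open>M\<close>:
  \<open>(a \<otimes> b) \<otimes> (c \<otimes> d) \<mapsto> (a \<otimes> c) \<otimes> (b \<otimes> d)\<close>.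
\<close>

definition tau23 where
  "tau23 R M =
     (let D = tensor R M M; T = tensor R D D in
        tensor_lift R T
          (\<lambda>x y. tensor_lift R T
             (\<lambda>a b. tensor_lift R T
                (\<lambda>c d. tens R D D (tens R M M a c) (tens R M M b d)) y) x))"

text \<open>
  For bilinear operations \<open>\<mu>\<close>, \<open>\<nu>\<close> on \<open>M\<close>, the linear map \<open>(\<mu>, \<nu>) = (\<mu> \<otimes> \<nu>) \<circ> \<tau>\<^sub>2\<^sub>3\<close> from
  \<open>(M \<otimes> M) \<otimes> (M \<otimes> M)\<close> to \<open>M \<otimes> M\<close>.
\<close>

definition op_pair ::
  "('k, 'm) ring_scheme \<Rightarrow> ('k, 'a, 'p) module_scheme \<Rightarrow> ('a \<Rightarrow> 'a \<Rightarrow> 'a) \<Rightarrow> ('a \<Rightarrow> 'a \<Rightarrow> 'a)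
     \<Rightarrow> (('a \<times> 'a \<Rightarrow> 'k) set \<times> ('a \<times> 'a \<Rightarrow> 'k) set \<Rightarrow> 'k) set \<Rightarrow> ('a \<times> 'a \<Rightarrow> 'k) set" where
  "op_pair R M \<mu> \<nu> = tensor_map R M M (tensor_lift R M \<mu>) (tensor_lift R M \<nu>) \<circ> tau23 R M"


section \<open>Bialgebras and Hopf algebras\<close>

text \<open>Unlike the locale \<^locale>\<open>algebra\<close> of the library, this does not require commutativity.\<close>

locale unital_algebra = module R A + ring A
  for R (structure) and A (structure) +
  assumes smult_mult_left:
    "\<lbrakk>r \<in> carrier R; x \<in> carrier A; y \<in> carrier A\<rbrakk>
       \<Longrightarrow> (r \<odot>\<^bsub>A\<^esub> x) \<otimes>\<^bsub>A\<^esub> y = r \<odot>\<^bsub>A\<^esub> (x \<otimes>\<^bsub>A\<^esub> y)"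
    and smult_mult_right:
    "\<lbrakk>r \<in> carrier R; x \<in> carrier A; y \<in> carrier A\<rbrakk>
       \<Longrightarrow> x \<otimes>\<^bsub>A\<^esub> (r \<odot>\<^bsub>A\<^esub> y) = r \<odot>\<^bsub>A\<^esub> (x \<otimes>\<^bsub>A\<^esub> y)"

record ('k, 'a) bialgebra = "('k, 'a) module" +
  comult :: "'a \<Rightarrow> ('a \<times> 'a \<Rightarrow> 'k) set"
  counit :: "'a \<Rightarrow> 'k"

locale bialgebra = unital_algebra R H
  for R :: "('k, 'm) ring_scheme" (structure) and H :: "('k, 'a, 'p) bialgebra_scheme" (structure) +
  assumes comult_linear: "comult H \<in> module_hom R H (tensor R H H)"
    and counit_linear: "counit H \<in> module_hom R H (regular_module R)"
    and coassoc:
    "x \<in> carrier H \<Longrightarrow>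
       tensor_assoc R H H H (tensor_map R (tensor R H H) H (comult H) (\<lambda>y. y) (comult H x)) =
       tensor_map R H (tensor R H H) (\<lambda>y. y) (comult H) (comult H x)"
    and counit_left:
    "x \<in> carrier H \<Longrightarrow> tensor_lift R H (\<lambda>a b. counit H a \<odot>\<^bsub>H\<^esub> b) (comult H x) = x"
    and counit_right:
    "x \<in> carrier H \<Longrightarrow> tensor_lift R H (\<lambda>a b. counit H b \<odot>\<^bsub>H\<^esub> a) (comult H x) = x"
    and comult_mult:
    "\<lbrakk>x \<in> carrier H; y \<in> carrier H\<rbrakk> \<Longrightarrow>
       comult H (x \<otimes>\<^bsub>H\<^esub> y) =
       op_pair R H (monoid.mult H) (monoid.mult H)
         (tens R (tensor R H H) (tensor R H H) (comult H x) (comult H y))"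
    and comult_one: "comult H \<one>\<^bsub>H\<^esub> = tens R H H \<one>\<^bsub>H\<^esub> \<one>\<^bsub>H\<^esub>"
    and counit_mult:
    "\<lbrakk>x \<in> carrier H; y \<in> carrier H\<rbrakk> \<Longrightarrow> counit H (x \<otimes>\<^bsub>H\<^esub> y) = counit H x \<otimes>\<^bsub>R\<^esub> counit H y"
    and counit_one: "counit H \<one>\<^bsub>H\<^esub> = \<one>\<^bsub>R\<^esub>"

definition is_antipode ::
  "('k, 'm) ring_scheme \<Rightarrow> ('k, 'a, 'p) bialgebra_scheme \<Rightarrow> ('a \<Rightarrow> 'a) \<Rightarrow> bool" where
  "is_antipode R H S \<longleftrightarrow>
     S \<in> module_hom R H H \<and>
     (\<forall>x\<in>carrier H.
        tensor_lift R H (monoid.mult H) (tensor_map R H H S (\<lambda>y. y) (comult H x)) =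
          counit H x \<odot>\<^bsub>H\<^esub> \<one>\<^bsub>H\<^esub> \<and>
        tensor_lift R H (monoid.mult H) (tensor_map R H H (\<lambda>y. y) S (comult H x)) =
          counit H x \<odot>\<^bsub>H\<^esub> \<one>\<^bsub>H\<^esub>)"

text \<open>The antipode is unique when it exists, so it is treated as a property of a bialgebra.\<close>

locale hopf_algebra = bialgebra +
  assumes antipode_exists: "\<exists>S. is_antipode R H S"

definition bialgebra_hom ::
  "('k, 'm) ring_scheme \<Rightarrow> ('k, 'a, 'p) bialgebra_scheme \<Rightarrow> ('k, 'b, 'q) bialgebra_scheme
     \<Rightarrow> ('a \<Rightarrow> 'b) set" where
  "bialgebra_hom R H H' =
     {\<phi> \<in> module_hom R H H'.
        (\<forall>x\<in>carrier H. \<forall>y\<in>carrier H. \<phi> (x \<otimes>\<^bsub>H\<^esub> y) = \<phi> x \<otimes>\<^bsub>H'\<^esub> \<phi> y) \<and>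
        \<phi> \<one>\<^bsub>H\<^esub> = \<one>\<^bsub>H'\<^esub> \<and>
        (\<forall>x\<in>carrier H. comult H' (\<phi> x) = tensor_map R H' H' \<phi> \<phi> (comult H x)) \<and>
        (\<forall>x\<in>carrier H. counit H' (\<phi> x) = counit H x)}"

definition hopf_algebra_hom ::
  "('k, 'm) ring_scheme \<Rightarrow> ('k, 'a, 'p) bialgebra_scheme \<Rightarrow> ('k, 'b, 'q) bialgebra_scheme
     \<Rightarrow> ('a \<Rightarrow> 'b) set" where
  "hopf_algebra_hom R H H' =
     {\<phi> \<in> bialgebra_hom R H H'.
        \<forall>S S'. is_antipode R H S \<longrightarrow> is_antipode R H' S' \<longrightarrow> (\<forall>x\<in>carrier H. \<phi> (S x) = S' (\<phi> x))}"


section \<open>Algebras, bialgebras and Hopf algebras with a grafting operation\<close>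

locale vee_algebra = unital_algebra R A
  for R (structure) and A (structure) +
  fixes vee :: "'a \<Rightarrow> 'a \<Rightarrow> 'a"
  assumes vee_bilinear: "bilinear_map R A A A vee"
    and vee_mult:
    "\<lbrakk>a1 \<in> carrier A; a2 \<in> carrier A; b1 \<in> carrier A; b2 \<in> carrier A\<rbrakk> \<Longrightarrow>
       vee a1 a2 \<otimes>\<^bsub>A\<^esub> vee b1 b2 =
       vee a1 (a2 \<otimes>\<^bsub>A\<^esub> vee b1 b2) \<oplus>\<^bsub>A\<^esub> vee (vee a1 a2 \<otimes>\<^bsub>A\<^esub> b1) b2"

record ('k, 'a) vee_bialgebra = "('k, 'a) bialgebra" +
  vee :: "'a \<Rightarrow> 'a \<Rightarrow> 'a"

definition cocycle_condition ::
  "('k, 'm) ring_scheme \<Rightarrow> ('k, 'a, 'p) vee_bialgebra_scheme \<Rightarrow> bool" where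
  "cocycle_condition R H \<longleftrightarrow>
     (\<forall>h\<in>carrier H. \<forall>h'\<in>carrier H.
        comult H (vee H h h') =
          tens R H H (vee H h h') \<one>\<^bsub>H\<^esub> \<oplus>\<^bsub>tensor R H H\<^esub>
          op_pair R H (monoid.mult H) (vee H)
            (tens R (tensor R H H) (tensor R H H) (comult H h) (comult H h')))"

definition cocycle_vee_bialgebra ::
  "('k, 'm) ring_scheme \<Rightarrow> ('k, 'a, 'p) vee_bialgebra_scheme \<Rightarrow> bool" where
  "cocycle_vee_bialgebra R H \<longleftrightarrow>
     bialgebra R H \<and> vee_algebra R H (vee H) \<and> cocycle_condition R H"

definition cocycle_vee_hopf_algebra ::
  "('k, 'm) ring_scheme \<Rightarrow> ('k, 'a, 'p) vee_bialgebra_scheme \<Rightarrow> bool" where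
  "cocycle_vee_hopf_algebra R H \<longleftrightarrow>
     hopf_algebra R H \<and> vee_algebra R H (vee H) \<and> cocycle_condition R H"

definition vee_bialgebra_hom ::
  "('k, 'm) ring_scheme \<Rightarrow> ('k, 'a, 'p) vee_bialgebra_scheme \<Rightarrow> ('k, 'b, 'q) vee_bialgebra_scheme
     \<Rightarrow> ('a \<Rightarrow> 'b) set" where
  "vee_bialgebra_hom R H H' =
     {\<phi> \<in> bialgebra_hom R H H'.
        \<forall>x\<in>carrier H. \<forall>y\<in>carrier H. \<phi> (vee H x y) = vee H' (\<phi> x) (\<phi> y)}"

definition vee_hopf_algebra_hom ::
  "('k, 'm) ring_scheme \<Rightarrow> ('k, 'a, 'p) vee_bialgebra_scheme \<Rightarrow> ('k, 'b, 'q) vee_bialgebra_scheme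
     \<Rightarrow> ('a \<Rightarrow> 'b) set" where
  "vee_hopf_algebra_hom R H H' =
     {\<phi> \<in> hopf_algebra_hom R H H'.
        \<forall>x\<in>carrier H. \<forall>y\<in>carrier H. \<phi> (vee H x y) = vee H' (\<phi> x) (\<phi> y)}"

text \<open>
  In the universal properties the target \<open>H'\<close> ranges over all structures whose carrier is a subset of
  the type given by the first argument; leaving that type a variable in a theorem covers all
  targets.  Only the values of a morphism on the carrier matter, so uniqueness is stated among
  extensional functions.
\<close>

definition free_cocycle_vee_bialgebra ::
  "'h itself \<Rightarrow> ('k, 'm) ring_scheme \<Rightarrow> 'x set \<Rightarrow> ('x \<Rightarrow> 'a) \<Rightarrow> ('k, 'a) vee_bialgebra \<Rightarrow> bool" where
  "free_cocycle_vee_bialgebra T R X j H \<longleftrightarrow>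
     cocycle_vee_bialgebra R H \<and> j \<in> X \<rightarrow> carrier H \<and>
     (\<forall>(H' :: ('k, 'h) vee_bialgebra) f.
        cocycle_vee_bialgebra R H' \<longrightarrow> f \<in> X \<rightarrow> carrier H' \<longrightarrow>
        (\<exists>!\<phi>. \<phi> \<in> extensional (carrier H) \<and> \<phi> \<in> vee_bialgebra_hom R H H' \<and>
               (\<forall>x\<in>X. \<phi> (j x) = f x)))"

definition free_cocycle_vee_hopf_algebra ::
  "'h itself \<Rightarrow> ('k, 'm) ring_scheme \<Rightarrow> 'x set \<Rightarrow> ('x \<Rightarrow> 'a) \<Rightarrow> ('k, 'a) vee_bialgebra \<Rightarrow> bool" where
  "free_cocycle_vee_hopf_algebra T R X j H \<longleftrightarrow>
     cocycle_vee_hopf_algebra R H \<and> j \<in> X \<rightarrow> carrier H \<and>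
     (\<forall>(H' :: ('k, 'h) vee_bialgebra) f.
        cocycle_vee_hopf_algebra R H' \<longrightarrow> f \<in> X \<rightarrow> carrier H' \<longrightarrow>
        (\<exists>!\<phi>. \<phi> \<in> extensional (carrier H) \<and> \<phi> \<in> vee_hopf_algebra_hom R H H' \<and>
               (\<forall>x\<in>X. \<phi> (j x) = f x)))"

definition initial_cocycle_vee_bialgebra ::
  "'h itself \<Rightarrow> ('k, 'm) ring_scheme \<Rightarrow> ('k, 'a) vee_bialgebra \<Rightarrow> bool" where
  "initial_cocycle_vee_bialgebra T R H \<longleftrightarrow>
     cocycle_vee_bialgebra R H \<and>
     (\<forall>H' :: ('k, 'h) vee_bialgebra. cocycle_vee_bialgebra R H' \<longrightarrow>
        (\<exists>!\<phi>. \<phi> \<in> extensional (carrier H) \<and> \<phi> \<in> vee_bialgebra_hom R H H'))"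

definition initial_cocycle_vee_hopf_algebra ::
  "'h itself \<Rightarrow> ('k, 'm) ring_scheme \<Rightarrow> ('k, 'a) vee_bialgebra \<Rightarrow> bool" where
  "initial_cocycle_vee_hopf_algebra T R H \<longleftrightarrow>
     cocycle_vee_hopf_algebra R H \<and>
     (\<forall>H' :: ('k, 'h) vee_bialgebra. cocycle_vee_hopf_algebra R H' \<longrightarrow>
        (\<exists>!\<phi>. \<phi> \<in> extensional (carrier H) \<and> \<phi> \<in> vee_hopf_algebra_hom R H H'))"


section \<open>The Loday-Ronco Hopf algebra\<close>

text \<open>
  \<open>Leaf\<close> is the tree \<open>|\<close>, and \<open>Node l r\<close> is the grafting of \<open>l\<close> and \<open>r\<close>; the number of interior
  vertices is the number of \<open>Node\<close> constructors.
\<close>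

datatype pbtree = Leaf | Node pbtree pbtree

abbreviation LR_module :: "('k, 'm) ring_scheme \<Rightarrow> ('k, pbtree \<Rightarrow> 'k) module" where
  "LR_module R \<equiv> free_module R UNIV"

definition LR_vee ::
  "('k, 'm) ring_scheme \<Rightarrow> (pbtree \<Rightarrow> 'k) \<Rightarrow> (pbtree \<Rightarrow> 'k) \<Rightarrow> (pbtree \<Rightarrow> 'k)" where
  "LR_vee R = bilin_ext R (LR_module R) (\<lambda>S T. basis_elt R (Node S T))"

fun LR_tree_mult :: "('k, 'm) ring_scheme \<Rightarrow> pbtree \<Rightarrow> pbtree \<Rightarrow> (pbtree \<Rightarrow> 'k)" where
  "LR_tree_mult R Leaf T = basis_elt R T"
| "LR_tree_mult R (Node l r) Leaf = basis_elt R (Node l r)"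
| "LR_tree_mult R (Node l r) (Node l' r') =
     LR_vee R (basis_elt R l) (LR_tree_mult R r (Node l' r')) \<oplus>\<^bsub>LR_module R\<^esub>
     LR_vee R (LR_tree_mult R (Node l r) l') (basis_elt R r')"

definition LR_mult ::
  "('k, 'm) ring_scheme \<Rightarrow> (pbtree \<Rightarrow> 'k) \<Rightarrow> (pbtree \<Rightarrow> 'k) \<Rightarrow> (pbtree \<Rightarrow> 'k)" where
  "LR_mult R = bilin_ext R (LR_module R) (LR_tree_mult R)"

primrec LR_tree_comult ::
  "('k, 'm) ring_scheme \<Rightarrow> pbtree \<Rightarrow> ((pbtree \<Rightarrow> 'k) \<times> (pbtree \<Rightarrow> 'k) \<Rightarrow> 'k) set" where
  "LR_tree_comult R Leaf =
     tens R (LR_module R) (LR_module R) (basis_elt R Leaf) (basis_elt R Leaf)"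
| "LR_tree_comult R (Node l r) =
     (let H = LR_module R; D = tensor R H H in
        tens R H H (basis_elt R (Node l r)) (basis_elt R Leaf) \<oplus>\<^bsub>D\<^esub>
        op_pair R H (LR_mult R) (LR_vee R)
          (tens R D D (LR_tree_comult R l) (LR_tree_comult R r)))"

definition LR_comult ::
  "('k, 'm) ring_scheme \<Rightarrow> (pbtree \<Rightarrow> 'k) \<Rightarrow> ((pbtree \<Rightarrow> 'k) \<times> (pbtree \<Rightarrow> 'k) \<Rightarrow> 'k) set" where
  "LR_comult R = lin_ext R (tensor R (LR_module R) (LR_module R)) (LR_tree_comult R)"

definition LR_counit :: "('k, 'm) ring_scheme \<Rightarrow> (pbtree \<Rightarrow> 'k) \<Rightarrow> 'k" where
  "LR_counit R =
     lin_ext R (regular_module R) (\<lambda>T. case T of Leaf \<Rightarrow> \<one>\<^bsub>R\<^esub> | Node l r \<Rightarrow> \<zero>\<^bsub>R\<^esub>)"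

definition H_LR :: "('k, 'm) ring_scheme \<Rightarrow> ('k, pbtree \<Rightarrow> 'k) vee_bialgebra" where
  "H_LR R =
     \<lparr>carrier = carrier (LR_module R), monoid.mult = LR_mult R, monoid.one = basis_elt R Leaf,
      ring.zero = ring.zero (LR_module R), ring.add = ring.add (LR_module R), smult = smult (LR_module R),
      comult = LR_comult R, counit = LR_counit R, vee = LR_vee R\<rparr>"

end

theory Submission
  imports Defs "HOL-Library.Multiset"
begin

text \<open>
  The structure constants of the product and the coproduct on trees are natural numbers, so both are
  images of operations on multisets of trees and of pairs of trees, where associativity,
  coassociativity and compatibility are proved by induction on trees; the key step is that
  \<open>(\<star>, \<curlyvee>)\<close> makes the pairs of trees a \<open>\<or>\<close>-algebra again.  Bilinearity and the universal
  property of the tensor product transport these identities to \<open>H\<^sub>L\<^sub>R\<close>.  Since the coproduct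
  preserves the total size, every map on trees with value \<open>1\<close> at \<open>|\<close> is invertible for convolution,
  which yields the antipode.  A morphism out of \<open>H\<^sub>L\<^sub>R\<close> is forced on trees by compatibility with
  \<open>\<or>\<close>; the map so defined is multiplicative and comultiplicative by the defining recursions, it
  respects the counit by the counit axiom of the target, and it commutes with antipodes because
  convolution inverses are unique.
\<close>

section \<open>Product and coproduct of trees as multisets\<close>

text \<open>Neither the product nor the coproduct has signs, so both live over the natural numbers.
  Multisets form a free commutative monoid with total operations and no carrier conditions, which
  leaves additive identities to the simplifier; \<open>mbind2\<close> is the biadditive extension of
  an operation on basis elements. The antipode does have signs and is therefore solved for in the
  algebra itself.

  The obstacle is the concrete tensor product: its elements are cosets in a free module on all pairs
  of elements, so tensors cannot simply be compared by coefficients in a basis. Identities of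
  tensors are instead pushed forward along the additive maps \<open>msum\<close> and
  \<open>pair_sum\<close>. These take an arbitrary family as parameter: the basis trees give the
  axioms of \<open>H_LR\<close>, and the trees evaluated in a target give the compatibilities of the
  morphism.

  Multiplicativity of the coproduct has to precede coassociativity, because the left factors of the
  coproduct of a grafting are products of trees.\<close>

definition mbind2 :: "('a \<Rightarrow> 'b \<Rightarrow> 'c multiset) \<Rightarrow> 'a multiset \<Rightarrow> 'b multiset \<Rightarrow> 'c multiset" where
  "mbind2 f A B = (\<Sum>a\<in>#A. \<Sum>b\<in>#B. f a b)"

lemma mbind2_simps [simp]:
  "mbind2 f {#} B = {#}" "mbind2 f A {#} = {#}"
  "mbind2 f {#a#} {#b#} = f a b"
  "mbind2 f (A + A') B = mbind2 f A B + mbind2 f A' B"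
  "mbind2 f A (B + B') = mbind2 f A B + mbind2 f A B'"
  by (simp_all add: mbind2_def sum_mset.distrib)

text \<open>Splitting into an arbitrary union, not into one element and the rest, matches the
  distributive laws of \<open>mbind2\<close>: an identity additive in each argument then reduces to
  singletons by simplification.\<close>

lemma mset_additive_induct [case_names empty single plus]:
  assumes "P {#}" "\<And>a. P {#a#}" "\<And>A B. P A \<Longrightarrow> P B \<Longrightarrow> P (A + B)"
  shows "P A"
proof (induction A)
  case (add a A)
  then show ?case
    using assms(2)[of a] assms(3)[of "{#a#}" A] by simp
qed (rule assms)

abbreviation mtimes :: "'a multiset \<Rightarrow> 'b multiset \<Rightarrow> ('a \<times> 'b) multiset" (infixr \<open>\<boxtimes>\<close> 75) where
  "A \<boxtimes> B \<equiv> mbind2 (\<lambda>a b. {#(a, b)#}) A B"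

text \<open>This is the basis form of \<open>op_pair\<close>, the tensor product of two operations
  after the exchange of the inner factors. Six type variables allow nesting, so that triples can be
  handled as pairs of an element and a pair.\<close>

definition pair_op ::
  "('a \<Rightarrow> 'b \<Rightarrow> 'c multiset) \<Rightarrow> ('d \<Rightarrow> 'e \<Rightarrow> 'f multiset)
     \<Rightarrow> ('a \<times> 'd) \<Rightarrow> ('b \<times> 'e) \<Rightarrow> ('c \<times> 'f) multiset" where
  "pair_op f g p q = f (fst p) (fst q) \<boxtimes> g (snd p) (snd q)"

lemma pair_op_Pair [simp]: "pair_op f g (a, b) (c, d) = f a c \<boxtimes> g b d"
  by (simp add: pair_op_def)

text \<open>Both sides are additive in all four arguments and agree on singletons by definition.
  This interchange law lets computations with pairs run in each factor separately.\<close>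

lemma mbind2_pair_op:
  "mbind2 (pair_op f g) (A \<boxtimes> B) (C \<boxtimes> D) = mbind2 f A C \<boxtimes> mbind2 g B D"
proof (induction A rule: mset_additive_induct)
  case (single a) show ?case
  proof (induction B rule: mset_additive_induct)
    case (single b) show ?case
    proof (induction C rule: mset_additive_induct)
      case (single c) show ?case
        by (induction D rule: mset_additive_induct) simp_all
    qed simp_all
  qed simp_all
qed simp_all

lemma in_mbind2_iff: "c \<in># mbind2 f A B \<longleftrightarrow> (\<exists>a\<in>#A. \<exists>b\<in>#B. c \<in># f a b)"
  by (auto simp: mbind2_def)

section \<open>The product of trees and its associativity\<close>

fun tree_mult :: "pbtree \<Rightarrow> pbtree \<Rightarrow> pbtree multiset" where
  "tree_mult Leaf T = {#T#}"
| "tree_mult (Node l r) Leaf = {#Node l r#}"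
| "tree_mult (Node l r) (Node l' r') =
     image_mset (Node l) (tree_mult r (Node l' r')) + image_mset (\<lambda>x. Node x r') (tree_mult (Node l r) l')"

lemma tree_mult_Leaf_right [simp]: "tree_mult T Leaf = {#T#}"
  by (cases T) simp_all

abbreviation graft :: "pbtree \<Rightarrow> pbtree \<Rightarrow> pbtree multiset" where
  "graft a b \<equiv> {#Node a b#}"

abbreviation mmult (infixl \<open>\<star>\<close> 80) where
  "A \<star> B \<equiv> mbind2 tree_mult A B"
abbreviation mgraft (infixl \<open>\<curlyvee>\<close> 78) where
  "A \<curlyvee> B \<equiv> mbind2 graft A B"

lemma image_mset_Node:
  "image_mset (Node l) A = {#l#} \<curlyvee> A"
  "image_mset (\<lambda>x. Node x r) A = A \<curlyvee> {#r#}"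
  by (induction A rule: mset_additive_induct; simp)+

lemma tree_mult_Node_Node:
  "tree_mult (Node l r) (Node l' r') =
     {#l#} \<curlyvee> tree_mult r (Node l' r') + tree_mult (Node l r) l' \<curlyvee> {#r'#}"
  by (simp add: image_mset_Node)

lemma mmult_Leaf [simp]: "{#Leaf#} \<star> A = A" "A \<star> {#Leaf#} = A"
  by (induction A rule: mset_additive_induct; simp)+

text \<open>On singletons this is the recursion for the product of two nodes, and every expression
  in it is additive in the four arguments.\<close>

lemma mmult_mgraft:
  "(A \<curlyvee> B) \<star> (C \<curlyvee> D) = A \<curlyvee> (B \<star> (C \<curlyvee> D)) + ((A \<curlyvee> B) \<star> C) \<curlyvee> D"
proof (induction A rule: mset_additive_induct)
  case (single a) show ?case
  proof (induction B rule: mset_additive_induct)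
    case (single b) show ?case
    proof (induction C rule: mset_additive_induct)
      case (single c) show ?case
        by (induction D rule: mset_additive_induct) (simp_all add: tree_mult_Node_Node del: tree_mult.simps)
    qed (simp_all add: ac_simps)
  qed (simp_all add: ac_simps)
qed (simp_all add: ac_simps)

text \<open>Write \<open>S\<close>, \<open>T\<close>, \<open>U\<close> as graftings. Both
  bracketings expand to three graftings: \<open>l\<close> with the product of \<open>r\<close>,
  \<open>T\<close>, \<open>U\<close>; the product of \<open>S\<close> and \<open>l'\<close> with the
  product of \<open>r'\<close> and \<open>U\<close>; and the product of \<open>S\<close>,
  \<open>T\<close>, \<open>l''\<close> with \<open>r''\<close>. The middle ones coincide, and the
  outer ones agree by induction for \<open>(r, T, U)\<close> and \<open>(S, T, l'')\<close>. Each of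
  these steps shrinks only one of the three trees, hence the induction on the total size.\<close>

lemma tree_mult_assoc: "tree_mult S T \<star> {#U#} = {#S#} \<star> tree_mult T U"
proof (induction "size S + size T + size U" arbitrary: S T U rule: less_induct)
  case less
  show ?case
  proof (cases "S = Leaf \<or> T = Leaf \<or> U = Leaf")
    case True then show ?thesis by auto
  next
    case False
    then obtain l r l' r' l'' r'' where S: "S = Node l r" and T: "T = Node l' r'" and U: "U = Node l'' r''"
      by (metis pbtree.exhaust)
    have Sg: "{#S#} = {#l#} \<curlyvee> {#r#}" and Tg: "{#T#} = {#l'#} \<curlyvee> {#r'#}" and Ug: "{#U#} = {#l''#} \<curlyvee> {#r''#}"
      by (simp_all add: S T U)
    have IH1: "({#r#} \<star> {#T#}) \<star> {#U#} = {#r#} \<star> ({#T#} \<star> {#U#})"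
      using less[of r T U] by (simp add: S)
    have IH2: "({#S#} \<star> {#T#}) \<star> {#l''#} = {#S#} \<star> ({#T#} \<star> {#l''#})"
      using less[of S T l''] by (simp add: U)
    have ST: "{#S#} \<star> {#T#} = {#l#} \<curlyvee> ({#r#} \<star> {#T#}) + ({#S#} \<star> {#l'#}) \<curlyvee> {#r'#}"
      unfolding Sg Tg by (rule mmult_mgraft)
    have TU: "{#T#} \<star> {#U#} = {#l'#} \<curlyvee> ({#r'#} \<star> {#U#}) + ({#T#} \<star> {#l''#}) \<curlyvee> {#r''#}"
      unfolding Tg Ug by (rule mmult_mgraft)
    have "({#S#} \<star> {#T#}) \<star> {#U#} = 
       {#l#} \<curlyvee> (({#r#} \<star> {#T#}) \<star> {#U#}) + ({#S#} \<star> {#l'#}) \<curlyvee> ({#r'#} \<star> {#U#}) 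
        + (({#S#} \<star> {#T#}) \<star> {#l''#}) \<curlyvee> {#r''#}"
      by (subst (1) ST, unfold Ug, simp only: mbind2_simps(4) mmult_mgraft) (subst ST, simp only: mbind2_simps(4) ac_simps)
    also have "\<dots> = {#S#} \<star> ({#T#} \<star> {#U#})"
    proof -
      have "{#S#} \<star> ({#T#} \<star> {#U#}) = ({#l#} \<curlyvee> {#r#}) \<star> ({#l'#} \<curlyvee> ({#r'#} \<star> {#U#}))
          + ({#l#} \<curlyvee> {#r#}) \<star> (({#T#} \<star> {#l''#}) \<curlyvee> {#r''#})"
        by (simp only: TU Sg mbind2_simps(4,5))
      also have "\<dots> = {#l#} \<curlyvee> ({#r#} \<star> ({#T#} \<star> {#U#})) + ({#S#} \<star> {#l'#}) \<curlyvee> ({#r'#} \<star> {#U#}) 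
          + ({#S#} \<star> ({#T#} \<star> {#l''#})) \<curlyvee> {#r''#}"
        by (simp only: mmult_mgraft) (simp only: TU Sg mbind2_simps(4,5) ac_simps)
      finally show ?thesis using IH1 IH2 by simp
    qed
    finally show ?thesis by simp
  qed
qed

lemma mmult_assoc: "(A \<star> B) \<star> C = A \<star> (B \<star> C)"
proof (induction A rule: mset_additive_induct)
  case (single a) show ?case
  proof (induction B rule: mset_additive_induct)
    case (single b) show ?case
      by (induction C rule: mset_additive_induct) (simp_all add: tree_mult_assoc)
  qed simp_all
qed simp_all

lemma size_tree_mult: "U \<in># tree_mult S T \<Longrightarrow> size U = size S + size T"
  by (induction S T arbitrary: U rule: tree_mult.induct) fastforce+

lemma Leaf_in_tree_mult: "Leaf \<in># tree_mult S T \<longleftrightarrow> S = Leaf \<and> T = Leaf"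
  by (cases S; cases T) auto

section \<open>The coproduct of trees and its multiplicativity\<close>

abbreviation mmult2 (infixl \<open>\<star>\<^sub>2\<close> 80) where
  "A \<star>\<^sub>2 B \<equiv> mbind2 (pair_op tree_mult tree_mult) A B"
abbreviation mgraft2 (infixl \<open>\<curlyvee>\<^sub>2\<close> 78) where
  "A \<curlyvee>\<^sub>2 B \<equiv> mbind2 (pair_op tree_mult graft) A B"

primrec tree_comult :: "pbtree \<Rightarrow> (pbtree \<times> pbtree) multiset" where
  "tree_comult Leaf = {#(Leaf, Leaf)#}"
| "tree_comult (Node l r) = {#(Node l r, Leaf)#} + tree_comult l \<curlyvee>\<^sub>2 tree_comult r"

abbreviation mcomult :: "pbtree multiset \<Rightarrow> (pbtree \<times> pbtree) multiset" where
  "mcomult A \<equiv> \<Sum>a\<in>#A. tree_comult a"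

lemma single_pair: "{#(a, b)#} = {#a#} \<boxtimes> {#b#}" by simp

text \<open>In the left factor this is associativity of the product; in the right factor the unit
  \<open>Leaf\<close> changes nothing. It handles the mixed terms in which a leading term
  \<open>(S, Leaf)\<close> meets the grafted part of another coproduct.\<close>

lemma mmult2_mgraft2_left:
  "({#(S, Leaf)#} \<star>\<^sub>2 A) \<curlyvee>\<^sub>2 B = {#(S, Leaf)#} \<star>\<^sub>2 (A \<curlyvee>\<^sub>2 B)"
proof (induction A rule: mset_additive_induct)
  case (single a) obtain a1 a2 where a: "a = (a1, a2)" by (cases a)
  show ?case
  proof (induction B rule: mset_additive_induct)
    case (single b) obtain b1 b2 where b: "b = (b1, b2)" by (cases b)
    show ?case unfolding a b single_pair[of a1 a2] single_pair[of b1 b2] single_pair[of S]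
      mbind2_pair_op by (simp only: mmult_Leaf mmult_assoc)
  qed simp_all
qed simp_all

lemma mmult2_mgraft2_right:
  "A \<curlyvee>\<^sub>2 (B \<star>\<^sub>2 {#(T, Leaf)#}) = (A \<curlyvee>\<^sub>2 B) \<star>\<^sub>2 {#(T, Leaf)#}"
proof (induction A rule: mset_additive_induct)
  case (single a) obtain a1 a2 where a: "a = (a1, a2)" by (cases a)
  show ?case
  proof (induction B rule: mset_additive_induct)
    case (single b) obtain b1 b2 where b: "b = (b1, b2)" by (cases b)
    show ?case unfolding a b single_pair[of a1 a2] single_pair[of b1 b2] single_pair[of T]
      mbind2_pair_op by (simp only: mmult_Leaf mmult_assoc)
  qed simp_all
qed simp_all

text \<open>By the interchange law, the right factors satisfy the grafting law for trees, while
  associativity gives both summands the same left factor, the product of the four left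
  factors.\<close>

lemma mmult2_mgraft2:
  "(A \<curlyvee>\<^sub>2 B) \<star>\<^sub>2 (C \<curlyvee>\<^sub>2 D) = A \<curlyvee>\<^sub>2 (B \<star>\<^sub>2 (C \<curlyvee>\<^sub>2 D)) + ((A \<curlyvee>\<^sub>2 B) \<star>\<^sub>2 C) \<curlyvee>\<^sub>2 D"
proof (induction A rule: mset_additive_induct)
  case (single a) obtain a1 a2 where a: "a = (a1, a2)" by (cases a)
  show ?case
  proof (induction B rule: mset_additive_induct)
    case (single b) obtain b1 b2 where b: "b = (b1, b2)" by (cases b)
    show ?case
    proof (induction C rule: mset_additive_induct)
      case (single c) obtain c1 c2 where c: "c = (c1, c2)" by (cases c)
      show ?case
      proof (induction D rule: mset_additive_induct)
        case (single d) obtain d1 d2 where d: "d = (d1, d2)" by (cases d)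
        show ?case unfolding a b c d single_pair[of a1 a2] single_pair[of b1 b2] single_pair[of c1 c2] single_pair[of d1 d2] mbind2_pair_op
          by (simp only: mmult_mgraft mmult_assoc mbind2_simps(4,5))
      qed simp_all
    qed (simp_all add: ac_simps)
  qed (simp_all add: ac_simps)
qed (simp_all add: ac_simps)

lemma mmult2_Leaf [simp]:
  "{#(Leaf, Leaf)#} \<star>\<^sub>2 A = A" "A \<star>\<^sub>2 {#(Leaf, Leaf)#} = A"
  by (induction A rule: mset_additive_induct; simp add: pair_op_def)+

lemma mcomult_graft:
  "mcomult (A \<curlyvee> B) = (A \<curlyvee> B) \<boxtimes> {#Leaf#} + mcomult A \<curlyvee>\<^sub>2 mcomult B"
proof (induction A rule: mset_additive_induct)
  case (single a) show ?case
    by (induction B rule: mset_additive_induct) (simp_all add: ac_simps)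
qed (simp_all add: ac_simps)

text \<open>Each coproduct is a leading term plus a grafted part, so the right-hand side has four
  terms. On the left, the cocycle condition applied to the two graftings in the product of
  \<open>S\<close> and \<open>T\<close> gives the leading term and two graftings of pairs. Splitting
  the inner coproducts of these once more yields the two mixed terms and the two summands of the
  product of the grafted parts.\<close>

lemma tree_comult_mult: "mcomult (tree_mult S T) = tree_comult S \<star>\<^sub>2 tree_comult T"
proof (induction S T rule: tree_mult.induct)
  case (3 l r l' r')
  define S where "S = Node l r" 
  define T where "T = Node l' r'"
  define X where "X = tree_comult l \<curlyvee>\<^sub>2 tree_comult r"
  define Y where "Y = tree_comult l' \<curlyvee>\<^sub>2 tree_comult r'"
  have dS: "tree_comult S = {#(S, Leaf)#} + X" and dT: "tree_comult T = {#(T, Leaf)#} + Y"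
    by (simp_all add: S_def T_def X_def Y_def)
  have ST: "tree_mult S T = {#l#} \<curlyvee> tree_mult r T + tree_mult S l' \<curlyvee> {#r'#}"
    unfolding S_def T_def by (rule tree_mult_Node_Node)
  have IH: "mcomult (tree_mult r T) = tree_comult r \<star>\<^sub>2 tree_comult T"
     "mcomult (tree_mult S l') = tree_comult S \<star>\<^sub>2 tree_comult l'"
    using 3 unfolding S_def T_def by simp_all
  have "mcomult (tree_mult S T) = tree_mult S T \<boxtimes> {#Leaf#}
     + tree_comult l \<curlyvee>\<^sub>2 (tree_comult r \<star>\<^sub>2 tree_comult T) + (tree_comult S \<star>\<^sub>2 tree_comult l') \<curlyvee>\<^sub>2 tree_comult r'"
    by (simp add: ST mcomult_graft IH ac_simps)
  also have "tree_comult l \<curlyvee>\<^sub>2 (tree_comult r \<star>\<^sub>2 tree_comult T) = 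
     X \<star>\<^sub>2 {#(T, Leaf)#} + tree_comult l \<curlyvee>\<^sub>2 (tree_comult r \<star>\<^sub>2 Y)"
    by (simp only: dT mbind2_simps mmult2_mgraft2_right X_def)
  also have "(tree_comult S \<star>\<^sub>2 tree_comult l') \<curlyvee>\<^sub>2 tree_comult r' = 
     {#(S, Leaf)#} \<star>\<^sub>2 Y + (X \<star>\<^sub>2 tree_comult l') \<curlyvee>\<^sub>2 tree_comult r'"
    by (simp only: dS mbind2_simps mmult2_mgraft2_left Y_def)
  also have "tree_mult S T \<boxtimes> {#Leaf#} = {#(S, Leaf)#} \<star>\<^sub>2 {#(T, Leaf)#}"
    by simp
  \<comment> \<open>The last two graftings are the two summands of the grafting law for pairs and
    recombine into the product of \<open>X\<close> and \<open>Y\<close>.\<close>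
  also have "{#(S, Leaf)#} \<star>\<^sub>2 {#(T, Leaf)#} + (X \<star>\<^sub>2 {#(T, Leaf)#} + tree_comult l \<curlyvee>\<^sub>2 (tree_comult r \<star>\<^sub>2 Y))
     + ({#(S, Leaf)#} \<star>\<^sub>2 Y + (X \<star>\<^sub>2 tree_comult l') \<curlyvee>\<^sub>2 tree_comult r')
     = {#(S, Leaf)#} \<star>\<^sub>2 {#(T, Leaf)#} + X \<star>\<^sub>2 {#(T, Leaf)#} + {#(S, Leaf)#} \<star>\<^sub>2 Y + X \<star>\<^sub>2 Y"
    using mmult2_mgraft2[of "tree_comult l" "tree_comult r" "tree_comult l'" "tree_comult r'"]
    unfolding X_def[symmetric] Y_def[symmetric] by (simp only: ac_simps)
  also have "\<dots> = tree_comult S \<star>\<^sub>2 tree_comult T"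
    unfolding dS dT by (simp only: mbind2_simps(4,5) ac_simps)
  finally show ?case unfolding S_def T_def .
qed simp_all

section \<open>Coassociativity of the tree coproduct\<close>

definition reassoc :: "(('a \<times> 'b) \<times> 'c) multiset \<Rightarrow> ('a \<times> 'b \<times> 'c) multiset" where
  "reassoc = image_mset (\<lambda>((a, b), c). (a, b, c))"

lemma reassoc_simps [simp]:
  "reassoc {#} = {#}" "reassoc (A + B) = reassoc A + reassoc B" 
  "reassoc {#((a, b), c)#} = {#(a, b, c)#}"
  by (simp_all add: reassoc_def)

abbreviation comult_left :: "(pbtree \<times> pbtree) multiset \<Rightarrow> (pbtree \<times> pbtree \<times> pbtree) multiset" where
  "comult_left A \<equiv> \<Sum>(a, b)\<in>#A. reassoc (tree_comult a \<boxtimes> {#b#})"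
abbreviation comult_right :: "(pbtree \<times> pbtree) multiset \<Rightarrow> (pbtree \<times> pbtree \<times> pbtree) multiset" where
  "comult_right A \<equiv> \<Sum>(a, b)\<in>#A. {#a#} \<boxtimes> tree_comult b"

lemma comult_left_mtimes: "comult_left (A \<boxtimes> B) = reassoc (mcomult A \<boxtimes> B)"
proof (induction A rule: mset_additive_induct)
  case (single a) show ?case
    by (induction B rule: mset_additive_induct) simp_all
qed simp_all

lemma comult_right_mtimes: "comult_right (A \<boxtimes> B) = A \<boxtimes> mcomult B"
proof (induction A rule: mset_additive_induct)
  case (single a) show ?case
    by (induction B rule: mset_additive_induct) simp_all
qed simp_all

text \<open>This multiplies in the first two factors and grafts in the third. Both iterated
  coproducts of a node obey a recursion in terms of it.\<close>

abbreviation mgraft3 (infixl \<open>\<curlyvee>\<^sub>3\<close> 78) where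
  "A \<curlyvee>\<^sub>3 B \<equiv> mbind2 (pair_op tree_mult (pair_op tree_mult graft)) A B"

lemma reassoc_mgraft3:
  "reassoc (A \<boxtimes> B) \<curlyvee>\<^sub>3 reassoc (C \<boxtimes> D) = reassoc ((A \<star>\<^sub>2 C) \<boxtimes> (B \<curlyvee> D))"
proof (induction A rule: mset_additive_induct)
  case (single a) obtain a1 a2 where a: "a = (a1, a2)" by (cases a)
  show ?case
  proof (induction B rule: mset_additive_induct)
    case (single b) show ?case
    proof (induction C rule: mset_additive_induct)
      case (single c) obtain c1 c2 where c: "c = (c1, c2)" by (cases c)
      show ?case
      proof (induction D rule: mset_additive_induct)
        case (single d) 
        have "A' \<boxtimes> B' \<boxtimes> {#e#} = reassoc ((A' \<boxtimes> B') \<boxtimes> {#e#})" for A' B' and e :: pbtree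
        proof (induction A' rule: mset_additive_induct)
          case (single a) show ?case
            by (induction B' rule: mset_additive_induct) simp_all
        qed simp_all
        then show ?case by (simp add: a c)
      qed simp_all
    qed simp_all
  qed simp_all
qed simp_all

text \<open>A left factor of a grafting of pairs is a product, and the coproduct of a product is the
  product of the coproducts by \<open>tree_comult_mult\<close>.\<close>

lemma comult_left_mgraft2: "comult_left (A \<curlyvee>\<^sub>2 B) = comult_left A \<curlyvee>\<^sub>3 comult_left B"
proof (induction A rule: mset_additive_induct)
  case (single a) obtain a1 a2 where a: "a = (a1, a2)" by (cases a)
  show ?case
  proof (induction B rule: mset_additive_induct)
    case (single b) obtain b1 b2 where b: "b = (b1, b2)" by (cases b)
    show ?case by (simp add: a b comult_left_mtimes tree_comult_mult reassoc_mgraft3)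
  qed simp_all
qed simp_all

text \<open>Here the coproduct hits a grafting in the right factor, so the cocycle condition
  contributes the extra term ending in \<open>Leaf\<close>.\<close>

lemma comult_right_mgraft2:
  "comult_right (A \<curlyvee>\<^sub>2 B) = reassoc ((A \<curlyvee>\<^sub>2 B) \<boxtimes> {#Leaf#}) + comult_right A \<curlyvee>\<^sub>3 comult_right B"
proof (induction A rule: mset_additive_induct)
  case (single a) obtain a1 a2 where a: "a = (a1, a2)" by (cases a)
  show ?case
  proof (induction B rule: mset_additive_induct)
    case (single b) obtain b1 b2 where b: "b = (b1, b2)" by (cases b)
    have "A' \<boxtimes> {#e#} = reassoc ((A' \<boxtimes> {#x#}) \<boxtimes> {#y#})" if "e = (x, y)" for A' :: "pbtree multiset" and x y :: pbtree and e
      unfolding that by (induction A' rule: mset_additive_induct) simp_all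
    then show ?case by (simp add: a b comult_right_mtimes mbind2_pair_op
        del: union_mset_add_mset_left union_mset_add_mset_right)
  qed (simp_all add: ac_simps)
qed (simp_all add: ac_simps)

text \<open>The extra term on the right is matched on the left by the coproduct of the leading tree:
  applied to \<open>(T, Leaf)\<close>, \<open>comult_left\<close> returns the whole coproduct of
  \<open>T\<close> with \<open>Leaf\<close> appended. What remains is a triple grafting of the
  induction hypotheses.\<close>

lemma tree_coassoc: "comult_left (tree_comult T) = comult_right (tree_comult T)"
proof (induction T)
  case (Node l r)
  then show ?case
    by (simp add: comult_left_mgraft2 comult_right_mgraft2
        del: union_mset_add_mset_left union_mset_add_mset_right)
qed simp

section \<open>Grading and counit of the tree coproduct\<close>

text \<open>Products add sizes, and in the grafted part the new vertex is counted in the right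
  factor. A term whose right factor is a node therefore has a left factor smaller than
  \<open>T\<close>, which is what recursions and inductions over coproduct terms rest on.\<close>

lemma size_tree_comult: "p \<in># tree_comult T \<Longrightarrow> size (fst p) + size (snd p) = size T"
  by (induction T arbitrary: p) (fastforce simp: in_mbind2_iff dest: size_tree_mult)+

lemma tree_counit_right: "filter_mset (\<lambda>p. snd p = Leaf) (tree_comult T) = {#(T, Leaf)#}"
proof (cases T)
  case (Node l r)
  have "filter_mset (\<lambda>p. snd p = Leaf) (tree_comult l \<curlyvee>\<^sub>2 tree_comult r) = {#}"
    by (auto simp: in_mbind2_iff)
  then show ?thesis using Node by simp
qed simp

text \<open>A product contains \<open>Leaf\<close> only if both factors are \<open>Leaf\<close>, so
  the condition on the left factor may be imposed on the arguments. By induction the surviving term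
  for a node is then the grafting of \<open>(Leaf, l)\<close> and \<open>(Leaf, r)\<close>.\<close>

lemma filter_mgraft2_Leaf:
  "filter_mset (\<lambda>p. fst p = Leaf) (A \<curlyvee>\<^sub>2 B) =
     filter_mset (\<lambda>p. fst p = Leaf) A \<curlyvee>\<^sub>2 filter_mset (\<lambda>p. fst p = Leaf) B"
proof (induction A rule: mset_additive_induct)
  case (single a) obtain a1 a2 where a: "a = (a1, a2)" by (cases a)
  show ?case
  proof (induction B rule: mset_additive_induct)
    case (single b) obtain b1 b2 where b: "b = (b1, b2)" by (cases b)
    show ?case
      by (auto simp: a b in_mbind2_iff Leaf_in_tree_mult)
  qed simp_all
qed simp_all

lemma tree_counit_left: "filter_mset (\<lambda>p. fst p = Leaf) (tree_comult T) = {#(Leaf, T)#}"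
  by (induction T) (simp_all add: filter_mgraft2_Leaf)

section \<open>Linear maps and free modules\<close>

lemma module_homI:
  assumes "\<And>x. x \<in> carrier M \<Longrightarrow> f x \<in> carrier N"
    and "\<And>x y. x \<in> carrier M \<Longrightarrow> y \<in> carrier M \<Longrightarrow> f (x \<oplus>\<^bsub>M\<^esub> y) = f x \<oplus>\<^bsub>N\<^esub> f y"
    and "\<And>r x. r \<in> carrier R \<Longrightarrow> x \<in> carrier M \<Longrightarrow> f (r \<odot>\<^bsub>M\<^esub> x) = r \<odot>\<^bsub>N\<^esub> f x"
  shows "f \<in> module_hom R M N"
  using assms by (auto simp: module_hom_def)

lemma
  assumes "f \<in> module_hom R M N"
  shows module_hom_closed: "x \<in> carrier M \<Longrightarrow> f x \<in> carrier N"
    and module_hom_add: "x \<in> carrier M \<Longrightarrow> y \<in> carrier M \<Longrightarrow> f (x \<oplus>\<^bsub>M\<^esub> y) = f x \<oplus>\<^bsub>N\<^esub> f y"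
    and module_hom_smult: "r \<in> carrier R \<Longrightarrow> x \<in> carrier M \<Longrightarrow> f (r \<odot>\<^bsub>M\<^esub> x) = r \<odot>\<^bsub>N\<^esub> f x"
  using assms by (auto simp: module_hom_def)

text \<open>Linearity concerns values on the carrier, while functions are total; this passes between
  functions that agree there, such as a map and its restriction.\<close>

lemma module_hom_cong:
  assumes "module R M" "f \<in> module_hom R M N" "\<And>x. x \<in> carrier M \<Longrightarrow> f x = g x"
  shows "g \<in> module_hom R M N"
proof -
  interpret M: module R M by fact
  show ?thesis
    by (rule module_homI) (use assms(2) in \<open>auto simp: module_hom_def simp flip: assms(3)\<close>)
qed

lemma module_hom_id: "(\<lambda>x. x) \<in> module_hom R M M"
  by (auto intro: module_homI)

lemma module_hom_compose:
  "f \<in> module_hom R M N \<Longrightarrow> g \<in> module_hom R N P \<Longrightarrow> (\<lambda>x. g (f x)) \<in> module_hom R M P"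
  by (auto simp: module_hom_def Pi_iff)

lemma module_hom_zero:
  assumes "module R M" "module R N" "f \<in> module_hom R M N"
  shows "f \<zero>\<^bsub>M\<^esub> = \<zero>\<^bsub>N\<^esub>"
proof -
  interpret M: module R M by fact
  interpret N: module R N by fact
  have "f (\<zero>\<^bsub>R\<^esub> \<odot>\<^bsub>M\<^esub> \<zero>\<^bsub>M\<^esub>) = \<zero>\<^bsub>R\<^esub> \<odot>\<^bsub>N\<^esub> f \<zero>\<^bsub>M\<^esub>"
    using assms(3) by (intro module_hom_smult) auto
  then show ?thesis
    using module_hom_closed[OF assms(3)] by simp
qed

lemma module_hom_uminus:
  assumes "module R M" "module R N" "f \<in> module_hom R M N" "x \<in> carrier M"
  shows "f (\<ominus>\<^bsub>M\<^esub> x) = \<ominus>\<^bsub>N\<^esub> f x"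
proof -
  interpret M: module R M by fact
  interpret N: module R N by fact
  have "f (\<ominus>\<^bsub>M\<^esub> x) \<oplus>\<^bsub>N\<^esub> f x = f (\<ominus>\<^bsub>M\<^esub> x \<oplus>\<^bsub>M\<^esub> x)"
    using assms(3,4) by (simp add: module_hom_add)
  also have "\<dots> = \<zero>\<^bsub>N\<^esub>"
    using assms by (simp add: M.M.l_neg module_hom_zero)
  finally show ?thesis
    using assms(4) module_hom_closed[OF assms(3)] by (intro N.M.minus_equality[symmetric]) auto
qed

lemma
  assumes "module R M" "module R N" "f \<in> module_hom R M N" "g \<in> module_hom R M N"
  shows module_hom_plus: "(\<lambda>x. f x \<oplus>\<^bsub>N\<^esub> g x) \<in> module_hom R M N"
    and module_hom_scale: "r \<in> carrier R \<Longrightarrow> (\<lambda>x. r \<odot>\<^bsub>N\<^esub> f x) \<in> module_hom R M N"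
proof -
  interpret M: module R M by fact
  interpret N: module R N by fact
  note hom = module_hom_closed[OF assms(3)] module_hom_closed[OF assms(4)]
    module_hom_add[OF assms(3)] module_hom_add[OF assms(4)]
    module_hom_smult[OF assms(3)] module_hom_smult[OF assms(4)]
  show "(\<lambda>x. f x \<oplus>\<^bsub>N\<^esub> g x) \<in> module_hom R M N"
    by (rule module_homI) (simp_all add: hom N.smult_r_distr N.M.add.m_ac)
  show "(\<lambda>x. r \<odot>\<^bsub>N\<^esub> f x) \<in> module_hom R M N" if "r \<in> carrier R"
    by (rule module_homI)
      (simp_all add: hom N.smult_r_distr that M.R.m_comm flip: N.smult_assoc1)
qed

lemma bilinear_mapI:
  assumes "\<And>a. a \<in> carrier M \<Longrightarrow> (\<lambda>b. \<beta> a b) \<in> module_hom R N P"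
    and "\<And>b. b \<in> carrier N \<Longrightarrow> (\<lambda>a. \<beta> a b) \<in> module_hom R M P"
  shows "bilinear_map R M N P \<beta>"
  using assms by (simp add: bilinear_map_def)

lemma
  assumes "bilinear_map R M N P \<beta>"
  shows bilinear_map_left: "b \<in> carrier N \<Longrightarrow> (\<lambda>a. \<beta> a b) \<in> module_hom R M P"
    and bilinear_map_right: "a \<in> carrier M \<Longrightarrow> \<beta> a \<in> module_hom R N P"
  using assms by (auto simp: bilinear_map_def)

lemma bilinear_map_closed:
  "bilinear_map R M N P \<beta> \<Longrightarrow> a \<in> carrier M \<Longrightarrow> b \<in> carrier N \<Longrightarrow> \<beta> a b \<in> carrier P"
  by (blast intro: module_hom_closed dest: bilinear_map_right)

lemma bilinear_map_compose:
  assumes "bilinear_map R M' N' P \<beta>" "f \<in> module_hom R M M'" "g \<in> module_hom R N N'"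
  shows "bilinear_map R M N P (\<lambda>a b. \<beta> (f a) (g b))"
proof (rule bilinear_mapI)
  show "(\<lambda>b. \<beta> (f a) (g b)) \<in> module_hom R N P" if "a \<in> carrier M" for a
    using module_hom_compose[OF assms(3) bilinear_map_right[OF assms(1)]]
      module_hom_closed[OF assms(2) that] by blast
  show "(\<lambda>a. \<beta> (f a) (g b)) \<in> module_hom R M P" if "b \<in> carrier N" for b
    using module_hom_compose[OF assms(2) bilinear_map_left[OF assms(1)]]
      module_hom_closed[OF assms(3) that] by blast
qed

lemma module_hom_bilinear_map:
  assumes "bilinear_map R M N P \<beta>" "f \<in> module_hom R P Q"
  shows "bilinear_map R M N Q (\<lambda>a b. f (\<beta> a b))"
  using assms by (auto intro!: bilinear_mapI dest: bilinear_map_left bilinear_map_right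
      intro: module_hom_compose)

lemma bilinear_map_smult:
  assumes "module R M" "module R N" "f \<in> module_hom R M (regular_module R)"
  shows "bilinear_map R M N N (\<lambda>a b. f a \<odot>\<^bsub>N\<^esub> b)"
proof -
  interpret M: module R M by fact
  interpret N: module R N by fact
  have f: "f a \<in> carrier R" if "a \<in> carrier M" for a
    using assms(3) that by (auto simp: module_hom_def regular_module_def)
  have add: "f (a \<oplus>\<^bsub>M\<^esub> a') = f a \<oplus>\<^bsub>R\<^esub> f a'" if "a \<in> carrier M" "a' \<in> carrier M" for a a'
    using assms(3) that by (auto simp: module_hom_def regular_module_def)
  have smult: "f (r \<odot>\<^bsub>M\<^esub> a) = r \<otimes>\<^bsub>R\<^esub> f a" if "a \<in> carrier M" "r \<in> carrier R" for a r
    using assms(3) that by (auto simp: module_hom_def regular_module_def)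
  have comm: "r \<odot>\<^bsub>N\<^esub> (r' \<odot>\<^bsub>N\<^esub> b) = r' \<odot>\<^bsub>N\<^esub> (r \<odot>\<^bsub>N\<^esub> b)"
    if "r \<in> carrier R" "r' \<in> carrier R" "b \<in> carrier N" for r r' b
    using that by (simp add: M.R.m_comm flip: N.smult_assoc1)
  show ?thesis
    by (intro bilinear_mapI module_homI)
      (simp_all add: f add smult comm N.smult_r_distr N.smult_l_distr N.smult_assoc1)
qed

section \<open>Free modules and linear extension\<close>

context cring
begin

lemma module_free_module:
  fixes S :: "'s set"
  shows "module R (free_module R S)"
proof (rule moduleI)
  have fin: "finite {s. f s \<oplus> g s \<noteq> \<zero>}"
    if "finite {s. f s \<noteq> \<zero>}" "finite {s. g s \<noteq> \<zero>}" for f g :: "'s \<Rightarrow> 'a"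
    by (rule finite_subset[OF _ finite_UnI[OF that]]) auto
  have fin': "finite {s. r \<otimes> f s \<noteq> \<zero>}"
    if "finite {s. f s \<noteq> \<zero>}" "r \<in> carrier R" for r and f :: "'s \<Rightarrow> 'a"
    using that by (rule_tac finite_subset[of _ "{s. f s \<noteq> \<zero>}"]) auto
  show "abelian_group (free_module R S)"
  proof (rule abelian_groupI)
    fix f assume f: "f \<in> carrier (free_module R S)"
    have "(\<lambda>s. \<ominus> f s) \<in> carrier (free_module R S)"
      using f finite_subset[of "{s. \<ominus> f s \<noteq> \<zero>}" "{s. f s \<noteq> \<zero>}"]
      by (fastforce simp: free_module_def)
    moreover have "(\<lambda>s. \<ominus> f s) \<oplus>\<^bsub>free_module R S\<^esub> f = \<zero>\<^bsub>free_module R S\<^esub>"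
      using f by (auto simp: free_module_def l_neg)
    ultimately show "\<exists>g\<in>carrier (free_module R S). g \<oplus>\<^bsub>free_module R S\<^esub> f = \<zero>\<^bsub>free_module R S\<^esub>"
      by blast
  qed (auto simp: free_module_def fin a_ac)
  show "cring R" by (rule cring_axioms)
  fix a x assume "a \<in> carrier R" "x \<in> carrier (free_module R S)"
  then show "a \<odot>\<^bsub>free_module R S\<^esub> x \<in> carrier (free_module R S)"
    by (auto simp: free_module_def fin')
qed (auto simp: free_module_def l_distr r_distr m_assoc)

lemma basis_elt_closed [simp]: "s \<in> S \<Longrightarrow> basis_elt R s \<in> carrier (free_module R S)"
  by (auto simp: free_module_def basis_elt_def)

text \<open>Setting one nonzero coefficient to zero shrinks the finite support strictly, and the
  removed part is a multiple of a basis element.\<close>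

lemma free_module_induct [consumes 1, case_names zero add]:
  assumes "f \<in> carrier (free_module R S)"
    and "P \<zero>\<^bsub>free_module R S\<^esub>"
    and "\<And>r s g. r \<in> carrier R \<Longrightarrow> s \<in> S \<Longrightarrow> g \<in> carrier (free_module R S) \<Longrightarrow> P g
      \<Longrightarrow> P (r \<odot>\<^bsub>free_module R S\<^esub> basis_elt R s \<oplus>\<^bsub>free_module R S\<^esub> g)"
  shows "P f"
proof -
  have "finite {s. f s \<noteq> \<zero>}" using assms(1) by (simp add: free_module_def)
  then show ?thesis
    using assms(1)
  proof (induction "{s. f s \<noteq> \<zero>}" arbitrary: f rule: finite_psubset_induct)
    case psubset
    show ?case
    proof (cases "\<exists>s. f s \<noteq> \<zero>")
      case False
      then have "f = \<zero>\<^bsub>free_module R S\<^esub>" by (auto simp: free_module_def)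
      then show ?thesis using assms(2) by simp
    next
      case True
      then obtain s where s: "f s \<noteq> \<zero>" by blast
      define g where "g = f(s := \<zero>)"
      have fs: "s \<in> S" "f s \<in> carrier R" using s psubset.prems by (auto simp: free_module_def)
      have g: "g \<in> carrier (free_module R S)"
        using psubset.prems by (auto simp: free_module_def g_def elim!: rev_finite_subset)
      have "{t. g t \<noteq> \<zero>} \<subset> {t. f t \<noteq> \<zero>}" using s by (auto simp: g_def)
      then have "P g" using psubset.hyps g by blast
      moreover have "f = f s \<odot>\<^bsub>free_module R S\<^esub> basis_elt R s \<oplus>\<^bsub>free_module R S\<^esub> g"
        using psubset.prems by (auto simp: free_module_def basis_elt_def g_def fun_eq_iff)
      ultimately show ?thesis using assms(3) fs g by metis
    qed
  qed
qed

lemma module_hom_free_eqI: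
  assumes "module R P" "h \<in> module_hom R (free_module R S) P" "k \<in> module_hom R (free_module R S) P"
    and "\<And>s. s \<in> S \<Longrightarrow> h (basis_elt R s) = k (basis_elt R s)"
    and "f \<in> carrier (free_module R S)"
  shows "h f = k f"
  using assms(5)
proof (induction rule: free_module_induct)
  case zero
  show ?case using module_hom_zero[OF module_free_module assms(1)] assms(2,3) by metis
next
  case (add r s g)
  interpret F: module R "free_module R S" by (rule module_free_module)
  show ?case
    using add assms(4) by (simp add: module_hom_add[OF assms(2)] module_hom_add[OF assms(3)]
        module_hom_smult[OF assms(2)] module_hom_smult[OF assms(3)])
qed

lemma bilinear_map_free_eqI:
  assumes "module R P" "bilinear_map R (free_module R S) (free_module R T) P \<beta>"
    and "bilinear_map R (free_module R S) (free_module R T) P \<gamma>"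
    and "\<And>s t. s \<in> S \<Longrightarrow> t \<in> T \<Longrightarrow> \<beta> (basis_elt R s) (basis_elt R t) = \<gamma> (basis_elt R s) (basis_elt R t)"
    and "f \<in> carrier (free_module R S)" "g \<in> carrier (free_module R T)"
  shows "\<beta> f g = \<gamma> f g"
proof (rule module_hom_free_eqI[where h = "\<lambda>f. \<beta> f g" and k = "\<lambda>f. \<gamma> f g"])
  fix s assume s: "s \<in> S"
  show "\<beta> (basis_elt R s) g = \<gamma> (basis_elt R s) g"
    by (rule module_hom_free_eqI[OF assms(1) bilinear_map_right[OF assms(2)] bilinear_map_right[OF assms(3)]])
      (use assms s in auto)
qed (use assms(1,5,6) bilinear_map_left[OF assms(2)] bilinear_map_left[OF assms(3)] in auto)

text \<open>The sum in \<open>lin_ext\<close> runs over the support, which varies with the argument.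
  Enlarging the index set adds only zero terms and lets sums for different arguments be
  compared.\<close>

lemma lin_ext_eq:
  assumes "module R P" "f \<in> carrier (free_module R S)" "g \<in> S \<rightarrow> carrier P"
    and "finite A" "{s. f s \<noteq> \<zero>} \<subseteq> A" "A \<subseteq> S"
  shows "lin_ext R P g f = (\<Oplus>\<^bsub>P\<^esub>s\<in>A. f s \<odot>\<^bsub>P\<^esub> g s)"
proof -
  interpret P: module R P by fact
  show ?thesis
    unfolding lin_ext_def
    by (rule P.M.add.finprod_mono_neutral_cong_left) (use assms in \<open>auto simp: free_module_def subset_iff Pi_iff\<close>)
qed

lemma lin_ext_hom:
  assumes "module R P" "g \<in> S \<rightarrow> carrier P"
  shows "lin_ext R P g \<in> module_hom R (free_module R S) P"
proof (rule module_homI)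
  interpret P: module R P by fact
  interpret F: module R "free_module R S" by (rule module_free_module)
  fix x assume x: "x \<in> carrier (free_module R S)"
  let ?supp = "\<lambda>f. {s. f s \<noteq> \<zero>}"
  have fin: "finite (?supp f)" "?supp f \<subseteq> S" "\<And>s. f s \<in> carrier R" if "f \<in> carrier (free_module R S)" for f
    using that by (auto simp: free_module_def)
  note [simp] = funcset_mem[OF assms(2)]
  show "lin_ext R P g x \<in> carrier P"
    unfolding lin_ext_def using fin[OF x] assms(2) by (intro P.M.finsum_closed) (auto simp: Pi_iff subset_iff)
  fix y assume y: "y \<in> carrier (free_module R S)"
  let ?A = "?supp x \<union> ?supp y"
  have A: "finite ?A" "?A \<subseteq> S" using fin[OF x] fin[OF y] by auto
  have "lin_ext R P g (x \<oplus>\<^bsub>free_module R S\<^esub> y) = (\<Oplus>\<^bsub>P\<^esub>s\<in>?A. (x \<oplus>\<^bsub>free_module R S\<^esub> y) s \<odot>\<^bsub>P\<^esub> g s)"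
    using A by (intro lin_ext_eq[OF assms(1) F.M.a_closed[OF x y] assms(2)]) (auto simp: free_module_def)
  also have "\<dots> = (\<Oplus>\<^bsub>P\<^esub>s\<in>?A. x s \<odot>\<^bsub>P\<^esub> g s \<oplus>\<^bsub>P\<^esub> y s \<odot>\<^bsub>P\<^esub> g s)"
    using A fin[OF x] fin[OF y] by (intro P.M.finsum_cong) (auto simp: free_module_def P.smult_l_distr subset_iff simp_implies_def)
  also have "\<dots> = (\<Oplus>\<^bsub>P\<^esub>s\<in>?A. x s \<odot>\<^bsub>P\<^esub> g s) \<oplus>\<^bsub>P\<^esub> (\<Oplus>\<^bsub>P\<^esub>s\<in>?A. y s \<odot>\<^bsub>P\<^esub> g s)"
    using A fin[OF x] fin[OF y] by (intro P.M.finsum_addf) (auto simp: subset_iff)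
  also have "\<dots> = lin_ext R P g x \<oplus>\<^bsub>P\<^esub> lin_ext R P g y"
    using A by (simp add: lin_ext_eq[OF assms(1) x assms(2), of ?A] lin_ext_eq[OF assms(1) y assms(2), of ?A])
  finally show "lin_ext R P g (x \<oplus>\<^bsub>free_module R S\<^esub> y) = lin_ext R P g x \<oplus>\<^bsub>P\<^esub> lin_ext R P g y" .
next
  interpret P: module R P by fact
  fix r x assume r: "r \<in> carrier R" and x: "x \<in> carrier (free_module R S)"
  interpret F: module R "free_module R S" by (rule module_free_module)
  let ?A = "{s. x s \<noteq> \<zero>}"
  have fin: "finite ?A" "?A \<subseteq> S" "\<And>s. x s \<in> carrier R"
    using x by (auto simp: free_module_def)
  \<comment> \<open>Zero divisors may shrink the support of the multiple, so the sum is taken over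
    the support of \<open>x\<close>.\<close>
  have "lin_ext R P g (r \<odot>\<^bsub>free_module R S\<^esub> x) = (\<Oplus>\<^bsub>P\<^esub>s\<in>?A. (r \<odot>\<^bsub>free_module R S\<^esub> x) s \<odot>\<^bsub>P\<^esub> g s)"
    using fin r by (intro lin_ext_eq[OF assms(1) F.smult_closed[OF r x] assms(2)]) (auto simp: free_module_def)
  also have "\<dots> = (\<Oplus>\<^bsub>P\<^esub>s\<in>?A. r \<odot>\<^bsub>P\<^esub> (x s \<odot>\<^bsub>P\<^esub> g s))"
    using fin r assms(2) by (intro P.M.finsum_cong) (auto simp: free_module_def P.smult_assoc1 subset_iff Pi_iff simp_implies_def)
  also have "\<dots> = r \<odot>\<^bsub>P\<^esub> lin_ext R P g x"
    unfolding lin_ext_def using fin r assms(2) 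
    by (intro P.finsum_smult_ldistr[symmetric]) (auto simp: subset_iff)
  finally show "lin_ext R P g (r \<odot>\<^bsub>free_module R S\<^esub> x) = r \<odot>\<^bsub>P\<^esub> lin_ext R P g x" .
qed

lemma lin_ext_basis:
  assumes "module R P" "g \<in> S \<rightarrow> carrier P" "s \<in> S"
  shows "lin_ext R P g (basis_elt R s) = g s"
proof -
  interpret P: module R P by fact
  have "lin_ext R P g (basis_elt R s) = (\<Oplus>\<^bsub>P\<^esub>t\<in>{s}. basis_elt R s t \<odot>\<^bsub>P\<^esub> g t)"
    by (rule lin_ext_eq[OF assms(1) basis_elt_closed[OF assms(3)] assms(2)]) (use assms in \<open>auto simp: basis_elt_def split: if_splits\<close>)
  then show ?thesis
    using funcset_mem[OF assms(2,3)] by (simp add: basis_elt_def)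
qed

text \<open>For fixed \<open>f\<close> the extension is a finite combination of the maps
  \<open>\<lambda>y. g y s\<close>, hence linear in the parameter. This supplies the linearity in
  the second variable wherever extensions are nested.\<close>

lemma lin_ext_param:
  assumes "module R P" "module R Q" "f \<in> carrier (free_module R S)"
    and "\<And>s. s \<in> S \<Longrightarrow> (\<lambda>y. g y s) \<in> module_hom R Q P"
  shows "(\<lambda>y. lin_ext R P (g y) f) \<in> module_hom R Q P"
proof -
  interpret P: module R P by fact
  interpret Q: module R Q by fact
  have hom: "lin_ext R P (g y) \<in> module_hom R (free_module R S) P" if "y \<in> carrier Q" for y
    by (rule lin_ext_hom) (use assms(1) that in \<open>auto intro: module_hom_closed[OF assms(4)]\<close>)
  have const: "(\<lambda>y. \<zero>\<^bsub>P\<^esub>) \<in> module_hom R Q P" by (rule module_homI) auto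
  show ?thesis
    using assms(3)
  proof (induction rule: free_module_induct)
    case zero
    show ?case
      by (rule module_hom_cong[OF assms(2) const])
        (simp add: module_hom_zero[OF module_free_module assms(1) hom])
  next
    case (add r s f)
    interpret F: module R "free_module R S" by (rule module_free_module)
    have basis: "lin_ext R P (g y) (basis_elt R s) = g y s" if "y \<in> carrier Q" for y
      by (rule lin_ext_basis) (use assms(1) that add in \<open>auto intro: module_hom_closed[OF assms(4)]\<close>)
    have "(\<lambda>y. r \<odot>\<^bsub>P\<^esub> g y s \<oplus>\<^bsub>P\<^esub> lin_ext R P (g y) f) \<in> module_hom R Q P"
      using add assms by (intro module_hom_plus module_hom_scale) auto
    then show ?case
      by (rule module_hom_cong[OF assms(2)])
        (use add in \<open>simp add: module_hom_add[OF hom] module_hom_smult[OF hom] basis\<close>)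
  qed
qed

lemma bilin_ext_bilinear:
  assumes "module R P" "\<And>s t. s \<in> S \<Longrightarrow> t \<in> T \<Longrightarrow> g s t \<in> carrier P"
  shows "bilinear_map R (free_module R S) (free_module R T) P (bilin_ext R P g)"
proof (rule bilinear_mapI)
  have hom: "lin_ext R P (g s) \<in> module_hom R (free_module R T) P" if "s \<in> S" for s
    using that assms by (intro lin_ext_hom) auto
  show "bilin_ext R P g a \<in> module_hom R (free_module R T) P" if "a \<in> carrier (free_module R S)" for a
    unfolding bilin_ext_def using that assms hom
    by (intro lin_ext_param[where S = S]) (auto intro: module_free_module)
  show "(\<lambda>a. bilin_ext R P g a b) \<in> module_hom R (free_module R S) P" if "b \<in> carrier (free_module R T)" for b
    unfolding bilin_ext_def using that assms
    by (intro lin_ext_hom) (auto intro: module_hom_closed[OF hom])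
qed

lemma bilin_ext_basis:
  assumes "module R P" "\<And>s t. s \<in> S \<Longrightarrow> t \<in> T \<Longrightarrow> g s t \<in> carrier P" "s \<in> S" "t \<in> T"
  shows "bilin_ext R P g (basis_elt R s) (basis_elt R t) = g s t"
proof -
  have "lin_ext R P (g s') (basis_elt R t) = g s' t" if "s' \<in> S" for s'
    using that assms by (intro lin_ext_basis[where S = T]) auto
  then show ?thesis
    unfolding bilin_ext_def using assms by (subst lin_ext_basis[where S = S]) auto
qed

end

section \<open>The universal property of the tensor product\<close>

locale tensor_modules = M: module R M + N: module R N
  for R :: "('k, 'm) ring_scheme" (structure)
    and M :: "('k, 'a, 'p) module_scheme" and N :: "('k, 'b, 'q) module_scheme"
begin

abbreviation F where "F \<equiv> free_module R (carrier M \<times> carrier N)"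
abbreviation K where "K \<equiv> tensor_ker R M N"

sublocale F: module R F by (rule M.R.module_free_module)

lemma tensor_rels_subset: "tensor_rels R M N \<subseteq> carrier F"
  unfolding tensor_rels_def Let_def by auto

lemma submodule_tensor_ker: "submodule K R F"
proof (rule F.submoduleI)
  \<comment> \<open>The whole free module belongs to the family being intersected, so the
    intersection is not taken over an empty family.\<close>
  have ex: "submodule (carrier F) R F \<and> tensor_rels R M N \<subseteq> carrier F"
    using F.carrier_is_submodule tensor_rels_subset by blast
  then show "K \<subseteq> carrier F" unfolding tensor_ker_def by blast
  show "\<zero>\<^bsub>F\<^esub> \<in> K" unfolding tensor_ker_def
    using subgroup.one_closed[OF submodule.axioms(1)] by fastforce
qed (auto simp: tensor_ker_def F.submoduleE)

lemma tensor_rels_ker: "tensor_rels R M N \<subseteq> K"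
  unfolding tensor_ker_def by blast

sublocale K: abelian_subgroup K F
  using submodule.axioms(1)[OF submodule_tensor_ker] F.M.abelian_group_axioms
  by (intro abelian_subgroupI3 additive_subgroup.intro)

lemma smult_ker: "r \<in> carrier R \<Longrightarrow> x \<in> K \<Longrightarrow> r \<odot>\<^bsub>F\<^esub> x \<in> K"
  using submodule.smult_closed[OF submodule_tensor_ker] .

lemma coset_eqI:
  assumes "f \<in> carrier F" "g \<in> carrier F" "f \<ominus>\<^bsub>F\<^esub> g \<in> K"
  shows "K +>\<^bsub>F\<^esub> f = K +>\<^bsub>F\<^esub> g"
  using assms K.a_rcos_module_rev[of g f] K.a_repr_independence'[of f g] by (simp add: a_minus_def)

lemma coset_eq_imp:
  assumes "f \<in> carrier F" "g \<in> K +>\<^bsub>F\<^esub> f"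
  shows "g \<in> carrier F" "g \<ominus>\<^bsub>F\<^esub> f \<in> K"
  using assms K.a_elemrcos_carrier K.a_rcos_module_imp by (auto simp: a_minus_def)

lemma tensor_carrier: "carrier (tensor R M N) = (\<lambda>f. K +>\<^bsub>F\<^esub> f) ` carrier F"
  by (auto simp: tensor_def Let_def A_RCOSETS_def')

lemma coset_closed [simp]: "f \<in> carrier F \<Longrightarrow> K +>\<^bsub>F\<^esub> f \<in> carrier (tensor R M N)"
  by (simp add: tensor_carrier)

lemma tensor_carrierE:
  assumes "X \<in> carrier (tensor R M N)"
  obtains f where "f \<in> carrier F" "X = K +>\<^bsub>F\<^esub> f"
  using assms unfolding tensor_carrier by blast

lemma coset_add [simp]:
  "f \<in> carrier F \<Longrightarrow> g \<in> carrier F \<Longrightarrow> (K +>\<^bsub>F\<^esub> f) \<oplus>\<^bsub>tensor R M N\<^esub> (K +>\<^bsub>F\<^esub> g) = K +>\<^bsub>F\<^esub> (f \<oplus>\<^bsub>F\<^esub> g)"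
  by (simp add: tensor_def Let_def K.a_rcos_sum)

text \<open>The definition takes a union over all representatives; it collapses to one coset because
  scalar multiples of elements of \<open>K\<close> stay in \<open>K\<close>.\<close>

lemma coset_smult [simp]:
  assumes "r \<in> carrier R" "f \<in> carrier F"
  shows "r \<odot>\<^bsub>tensor R M N\<^esub> (K +>\<^bsub>F\<^esub> f) = K +>\<^bsub>F\<^esub> (r \<odot>\<^bsub>F\<^esub> f)"
proof -
  have "K +>\<^bsub>F\<^esub> (r \<odot>\<^bsub>F\<^esub> g) = K +>\<^bsub>F\<^esub> (r \<odot>\<^bsub>F\<^esub> f)" if "g \<in> K +>\<^bsub>F\<^esub> f" for g
  proof (rule coset_eqI)
    note g = coset_eq_imp[OF assms(2) that]
    have "r \<odot>\<^bsub>F\<^esub> g \<ominus>\<^bsub>F\<^esub> r \<odot>\<^bsub>F\<^esub> f = r \<odot>\<^bsub>F\<^esub> (g \<ominus>\<^bsub>F\<^esub> f)"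
      using assms g by (simp add: a_minus_def F.smult_r_distr F.smult_r_minus)
    then show "r \<odot>\<^bsub>F\<^esub> g \<ominus>\<^bsub>F\<^esub> r \<odot>\<^bsub>F\<^esub> f \<in> K" using g assms smult_ker by simp
  qed (use assms coset_eq_imp[OF assms(2) that] in auto)
  moreover have "f \<in> K +>\<^bsub>F\<^esub> f" using assms K.a_rcos_self by blast
  ultimately have "(\<Union>g\<in>K +>\<^bsub>F\<^esub> f. K +>\<^bsub>F\<^esub> (r \<odot>\<^bsub>F\<^esub> g)) = K +>\<^bsub>F\<^esub> (r \<odot>\<^bsub>F\<^esub> f)"
    by (intro UN_constant_eq ballI)
  then show ?thesis
    by (simp add: tensor_def Let_def)
qed

lemma module_tensor: "module R (tensor R M N)"
proof (rule moduleI)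
  show "cring R" by (rule M.R.cring_axioms)
  \<comment> \<open>The additive part is the factor group of \<open>F\<close> by \<open>K\<close>,
    from which the group axioms are inherited.\<close>
  have quot: "tensor R M N = \<lparr>carrier = carrier (F A_Mod K), monoid.mult = undefined, monoid.one = undefined,
      ring.zero = one (F A_Mod K), ring.add = monoid.mult (F A_Mod K), smult = smult (tensor R M N)\<rparr>"
    by (simp add: tensor_def Let_def A_FactGroup_def')
  show "abelian_group (tensor R M N)"
    using comm_groupE[OF K.a_factorgroup_is_comm_group]
    by (subst quot, intro abelian_groupI) (simp_all del: add_A_FactGroup)
qed (auto elim!: tensor_carrierE simp: F.smult_l_distr F.smult_r_distr F.smult_assoc1)

lemma tens_closed [simp]:
  "a \<in> carrier M \<Longrightarrow> b \<in> carrier N \<Longrightarrow> tens R M N a b \<in> carrier (tensor R M N)"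
  by (simp add: tens_def)

text \<open>In each of the four laws the difference of the representatives is one of the generators
  of \<open>K\<close>.\<close>

lemma tens_bilinear: "bilinear_map R M N (tensor R M N) (tens R M N)"
proof -
  note rel = subsetD[OF tensor_rels_ker]
  have "tens R M N (a \<oplus>\<^bsub>M\<^esub> a') b = tens R M N a b \<oplus>\<^bsub>tensor R M N\<^esub> tens R M N a' b"
    if "a \<in> carrier M" "a' \<in> carrier M" "b \<in> carrier N" for a a' b
    using that
    by (simp add: tens_def) (rule coset_eqI; (rule rel, unfold tensor_rels_def Let_def, blast)?; simp)
  moreover have "tens R M N a (b \<oplus>\<^bsub>N\<^esub> b') = tens R M N a b \<oplus>\<^bsub>tensor R M N\<^esub> tens R M N a b'"
    if "a \<in> carrier M" "b \<in> carrier N" "b' \<in> carrier N" for a b b'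
    using that
    by (simp add: tens_def) (rule coset_eqI; (rule rel, unfold tensor_rels_def Let_def, blast)?; simp)
  moreover have "tens R M N (r \<odot>\<^bsub>M\<^esub> a) b = r \<odot>\<^bsub>tensor R M N\<^esub> tens R M N a b"
    if "r \<in> carrier R" "a \<in> carrier M" "b \<in> carrier N" for r a b
    using that
    by (simp add: tens_def) (rule coset_eqI; (rule rel, unfold tensor_rels_def Let_def, blast)?; simp)
  moreover have "tens R M N a (r \<odot>\<^bsub>N\<^esub> b) = r \<odot>\<^bsub>tensor R M N\<^esub> tens R M N a b"
    if "r \<in> carrier R" "a \<in> carrier M" "b \<in> carrier N" for r a b
    using that
    by (simp add: tens_def) (rule coset_eqI; (rule rel, unfold tensor_rels_def Let_def, blast)?; simp)
  ultimately show ?thesis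
    by (intro bilinear_mapI module_homI) simp_all
qed

text \<open>The kernel of the linear extension of \<open>\<beta>\<close> is a submodule containing
  the bilinearity relations, hence contains \<open>K\<close>. The image of a coset is thus a
  singleton, which gives \<open>the_elem\<close> its meaning.\<close>

lemma tensor_lift_coset:
  assumes "module R P" "bilinear_map R M N P \<beta>" "f \<in> carrier F"
  shows "tensor_lift R P \<beta> (K +>\<^bsub>F\<^esub> f) = lin_ext R P (\<lambda>(a, b). \<beta> a b) f"
proof -
  interpret P: module R P by fact
  let ?L = "lin_ext R P (\<lambda>(a, b). \<beta> a b)"
  note \<beta> = bilinear_map_closed[OF assms(2)]
  have clos: "(\<lambda>(a, b). \<beta> a b) \<in> carrier M \<times> carrier N \<rightarrow> carrier P"
    using \<beta> by auto
  have L: "?L \<in> module_hom R F P"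
    using assms(1) clos by (rule M.R.lin_ext_hom)
  note hom = module_hom_closed[OF L] module_hom_add[OF L] module_hom_smult[OF L]
    module_hom_zero[OF F.module_axioms P.module_axioms L]
    module_hom_uminus[OF F.module_axioms P.module_axioms L]
  have basis: "?L (basis_elt R (a, b)) = \<beta> a b" if "a \<in> carrier M" "b \<in> carrier N" for a b
    using M.R.lin_ext_basis[OF assms(1) clos, of "(a, b)"] that by simp
  have "submodule {f \<in> carrier F. ?L f = \<zero>\<^bsub>P\<^esub>} R F"
    by (rule F.submoduleI) (auto simp: hom)
  moreover have "tensor_rels R M N \<subseteq> {f \<in> carrier F. ?L f = \<zero>\<^bsub>P\<^esub>}"
    using tensor_rels_subset
    by (auto simp: tensor_rels_def Let_def a_minus_def hom basis \<beta> P.M.r_neg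
        module_hom_add[OF bilinear_map_left[OF assms(2)]] module_hom_add[OF bilinear_map_right[OF assms(2)]]
        module_hom_smult[OF bilinear_map_left[OF assms(2)]] module_hom_smult[OF bilinear_map_right[OF assms(2)]])
  ultimately have ker: "?L f = \<zero>\<^bsub>P\<^esub>" if "f \<in> K" for f
    using that unfolding tensor_ker_def by blast
  have "?L g = ?L f" if "g \<in> K +>\<^bsub>F\<^esub> f" for g
  proof -
    note g = coset_eq_imp[OF assms(3) that]
    have "?L g \<ominus>\<^bsub>P\<^esub> ?L f = \<zero>\<^bsub>P\<^esub>"
      using ker[OF g(2)] g(1) assms(3) by (simp add: hom a_minus_def)
    then show ?thesis
      using hom(1)[OF g(1)] hom(1)[OF assms(3)] P.M.add.inv_solve_right'[of "\<zero>\<^bsub>P\<^esub>" "?L g" "?L f"]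
      by (simp add: a_minus_def)
  qed
  then have "?L ` (K +>\<^bsub>F\<^esub> f) = {?L f}"
    using K.a_rcos_self[OF assms(3)] by blast
  then show ?thesis by (simp add: tensor_lift_def)
qed

lemma tensor_lift_tens:
  assumes "module R P" "bilinear_map R M N P \<beta>" "a \<in> carrier M" "b \<in> carrier N"
  shows "tensor_lift R P \<beta> (tens R M N a b) = \<beta> a b"
proof -
  have "(\<lambda>(a, b). \<beta> a b) \<in> carrier M \<times> carrier N \<rightarrow> carrier P"
    using bilinear_map_closed[OF assms(2)] by auto
  from M.R.lin_ext_basis[OF assms(1) this, of "(a, b)"] show ?thesis
    using assms by (simp add: tens_def tensor_lift_coset)
qed

lemma tensor_lift_hom:
  assumes "module R P" "bilinear_map R M N P \<beta>"
  shows "tensor_lift R P \<beta> \<in> module_hom R (tensor R M N) P"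
proof -
  have "(\<lambda>(a, b). \<beta> a b) \<in> carrier M \<times> carrier N \<rightarrow> carrier P"
    using bilinear_map_closed[OF assms(2)] by auto
  from M.R.lin_ext_hom[OF assms(1) this] show ?thesis
    by (intro module_homI; elim tensor_carrierE)
      (simp_all add: tensor_lift_coset[OF assms] module_hom_closed module_hom_add module_hom_smult)
qed

text \<open>A representative of \<open>X\<close> can be chosen independently of \<open>y\<close>,
  which reduces the claim to \<open>lin_ext_param\<close>.\<close>

lemma tensor_lift_param:
  assumes "module R P" "module R Q" "X \<in> carrier (tensor R M N)"
    and "\<And>y. y \<in> carrier Q \<Longrightarrow> bilinear_map R M N P (\<beta> y)"
    and "\<And>a b. a \<in> carrier M \<Longrightarrow> b \<in> carrier N \<Longrightarrow> (\<lambda>y. \<beta> y a b) \<in> module_hom R Q P"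
  shows "(\<lambda>y. tensor_lift R P (\<beta> y) X) \<in> module_hom R Q P"
proof -
  obtain f where f: "f \<in> carrier F" "X = K +>\<^bsub>F\<^esub> f" using assms(3) by (rule tensor_carrierE)
  have "(\<lambda>y. lin_ext R P (\<lambda>(a, b). \<beta> y a b) f) \<in> module_hom R Q P"
    by (rule M.R.lin_ext_param[OF assms(1,2) f(1)]) (use assms(5) in auto)
  then show ?thesis
    by (rule module_hom_cong[OF assms(2)]) (simp add: f tensor_lift_coset assms(1,4))
qed

end

lemma tensor_modulesI: "module R M \<Longrightarrow> module R N \<Longrightarrow> tensor_modules R M N"
  by (simp add: tensor_modules_def)

lemmas module_tensor = tensor_modules.module_tensor[OF tensor_modulesI]
lemmas tens_closed = tensor_modules.tens_closed[OF tensor_modulesI]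
lemmas tens_bilinear = tensor_modules.tens_bilinear[OF tensor_modulesI]
lemmas tensor_lift_tens = tensor_modules.tensor_lift_tens[OF tensor_modulesI]
lemmas tensor_lift_hom = tensor_modules.tensor_lift_hom[OF tensor_modulesI]
lemmas tensor_lift_param = tensor_modules.tensor_lift_param[OF tensor_modulesI]

section \<open>Maps between tensor products\<close>

lemma tensor_map_bilinear:
  assumes "module R M'" "module R N'" "f \<in> module_hom R M M'" "g \<in> module_hom R N N'"
  shows "bilinear_map R M N (tensor R M' N') (\<lambda>a b. tens R M' N' (f a) (g b))"
  using bilinear_map_compose[OF tens_bilinear[OF assms(1,2)] assms(3,4)] .

lemma tensor_map_hom:
  assumes "module R M" "module R N" "module R M'" "module R N'"
    and "f \<in> module_hom R M M'" "g \<in> module_hom R N N'"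
  shows "tensor_map R M' N' f g \<in> module_hom R (tensor R M N) (tensor R M' N')"
  unfolding tensor_map_def
  by (rule tensor_lift_hom[OF assms(1,2) module_tensor[OF assms(3,4)] tensor_map_bilinear[OF assms(3-6)]])

lemma tensor_map_tens:
  assumes "module R M" "module R N" "module R M'" "module R N'"
    and "f \<in> module_hom R M M'" "g \<in> module_hom R N N'" "a \<in> carrier M" "b \<in> carrier N"
  shows "tensor_map R M' N' f g (tens R M N a b) = tens R M' N' (f a) (g b)"
  unfolding tensor_map_def
  by (rule tensor_lift_tens[OF assms(1,2) module_tensor[OF assms(3,4)] tensor_map_bilinear[OF assms(3-6)] assms(7,8)])

section \<open>The associator of tensor products\<close>

context
  fixes R :: "('k, 'm) ring_scheme" and L :: "('k, 'a, 'p) module_scheme"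
    and M :: "('k, 'b, 'q) module_scheme" and N :: "('k, 'c, 'r) module_scheme"
  assumes L: "module R L" and M: "module R M" and N: "module R N"
begin

private lemma MN: "module R (tensor R M N)" and LM: "module R (tensor R L M)"
  and T: "module R (tensor R L (tensor R M N))"
  using L M N by (simp_all add: module_tensor)

private lemma assoc_inner:
  assumes "c \<in> carrier N"
  shows "bilinear_map R L M (tensor R L (tensor R M N)) (\<lambda>a b. tens R L (tensor R M N) a (tens R M N b c))"
  by (rule bilinear_map_compose[OF tens_bilinear[OF L MN] module_hom_id bilinear_map_left[OF tens_bilinear[OF M N] assms]])

private lemma assoc_outer:
  "bilinear_map R (tensor R L M) N (tensor R L (tensor R M N))
     (\<lambda>x c. tensor_lift R (tensor R L (tensor R M N)) (\<lambda>a b. tens R L (tensor R M N) a (tens R M N b c)) x)"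
proof (rule bilinear_mapI)
  show "(\<lambda>c. tensor_lift R (tensor R L (tensor R M N)) (\<lambda>a b. tens R L (tensor R M N) a (tens R M N b c)) x)
      \<in> module_hom R N (tensor R L (tensor R M N))" if "x \<in> carrier (tensor R L M)" for x
    by (rule tensor_lift_param[OF L M T N that assoc_inner])
      (assumption, rule module_hom_compose[OF bilinear_map_right[OF tens_bilinear[OF M N]]
        bilinear_map_right[OF tens_bilinear[OF L MN]]])
qed (rule tensor_lift_hom[OF L M T assoc_inner])

lemma tensor_assoc_hom:
  "tensor_assoc R L M N \<in> module_hom R (tensor R (tensor R L M) N) (tensor R L (tensor R M N))"
  unfolding tensor_assoc_def Let_def by (rule tensor_lift_hom[OF LM N T assoc_outer])

lemma tensor_assoc_tens:
  assumes "a \<in> carrier L" "b \<in> carrier M" "c \<in> carrier N"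
  shows "tensor_assoc R L M N (tens R (tensor R L M) N (tens R L M a b) c) =
    tens R L (tensor R M N) a (tens R M N b c)"
  unfolding tensor_assoc_def Let_def
  by (simp add: tensor_lift_tens[OF LM N T assoc_outer] tensor_lift_tens[OF L M T assoc_inner]
      tens_closed[OF L M] assms)

end

section \<open>Exchange of inner factors and paired operations\<close>

context
  fixes R :: "('k, 'm) ring_scheme" and M :: "('k, 'a, 'p) module_scheme"
  assumes M: "module R M"
begin

private abbreviation D where "D \<equiv> tensor R M M"
private abbreviation T where "T \<equiv> tensor R D D"

private lemma mod_D: "module R D" and mod_T: "module R T"
  using M by (simp_all add: module_tensor)

private lemma tau1:
  "a \<in> carrier M \<Longrightarrow> b \<in> carrier M \<Longrightarrow>
    bilinear_map R M M T (\<lambda>c d. tens R D D (tens R M M a c) (tens R M M b d))"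
  by (intro bilinear_map_compose[OF tens_bilinear[OF mod_D mod_D]] bilinear_map_right[OF tens_bilinear[OF M M]])

private lemma tau2:
  assumes "y \<in> carrier D"
  shows "bilinear_map R M M T (\<lambda>a b. tensor_lift R T (\<lambda>c d. tens R D D (tens R M M a c) (tens R M M b d)) y)"
proof (rule bilinear_mapI)
  show "(\<lambda>b. tensor_lift R T (\<lambda>c d. tens R D D (tens R M M a c) (tens R M M b d)) y) \<in> module_hom R M T"
    if "a \<in> carrier M" for a
    using that by (intro tensor_lift_param[OF M M mod_T M assms tau1]
        module_hom_compose[OF bilinear_map_left[OF tens_bilinear[OF M M]] bilinear_map_right[OF tens_bilinear[OF mod_D mod_D]]])
      (auto intro: tens_closed[OF M M])
  show "(\<lambda>a. tensor_lift R T (\<lambda>c d. tens R D D (tens R M M a c) (tens R M M b d)) y) \<in> module_hom R M T"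
    if "b \<in> carrier M" for b
    using that by (intro tensor_lift_param[OF M M mod_T M assms tau1]
        module_hom_compose[OF bilinear_map_left[OF tens_bilinear[OF M M]] bilinear_map_left[OF tens_bilinear[OF mod_D mod_D]]])
      (auto intro: tens_closed[OF M M])
qed

text \<open>In a nested lift, linearity in the tensor being lifted comes from
  \<open>tensor_lift_hom\<close>, and linearity in the other one, which enters only through the
  integrand, from \<open>tensor_lift_param\<close>.\<close>

private lemma tau3:
  "bilinear_map R D D T (\<lambda>x y. tensor_lift R T
     (\<lambda>a b. tensor_lift R T (\<lambda>c d. tens R D D (tens R M M a c) (tens R M M b d)) y) x)"
proof (rule bilinear_mapI)
  show "(\<lambda>y. tensor_lift R T
     (\<lambda>a b. tensor_lift R T (\<lambda>c d. tens R D D (tens R M M a c) (tens R M M b d)) y) x) \<in> module_hom R D T"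
    if "x \<in> carrier D" for x
    by (rule tensor_lift_param[OF M M mod_T mod_D that tau2]) (assumption, rule tensor_lift_hom[OF M M mod_T tau1])
qed (rule tensor_lift_hom[OF M M mod_T tau2])

lemma tau23_hom: "tau23 R M \<in> module_hom R T T"
  unfolding tau23_def Let_def by (rule tensor_lift_hom[OF mod_D mod_D mod_T tau3])

lemma tau23_tens:
  assumes "a \<in> carrier M" "b \<in> carrier M" "c \<in> carrier M" "d \<in> carrier M"
  shows "tau23 R M (tens R D D (tens R M M a b) (tens R M M c d)) =
    tens R D D (tens R M M a c) (tens R M M b d)"
  unfolding tau23_def Let_def
  by (simp add: tensor_lift_tens[OF mod_D mod_D mod_T tau3] tensor_lift_tens[OF M M mod_T tau2] tensor_lift_tens[OF M M mod_T tau1]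
      tens_closed[OF M M] assms)

lemma op_pair_hom:
  assumes "bilinear_map R M M M \<mu>" "bilinear_map R M M M \<nu>"
  shows "op_pair R M \<mu> \<nu> \<in> module_hom R T D"
  unfolding op_pair_def comp_def
  by (rule module_hom_compose[OF tau23_hom tensor_map_hom[OF mod_D mod_D M M]]; rule tensor_lift_hom[OF M M M]; fact)

lemma op_pair_bilinear:
  assumes "bilinear_map R M M M \<mu>" "bilinear_map R M M M \<nu>"
  shows "bilinear_map R D D D (\<lambda>X Y. op_pair R M \<mu> \<nu> (tens R D D X Y))"
  by (rule module_hom_bilinear_map[OF tens_bilinear[OF mod_D mod_D] op_pair_hom[OF assms]])

lemma op_pair_tens:
  assumes "bilinear_map R M M M \<mu>" "bilinear_map R M M M \<nu>"
    and "a \<in> carrier M" "b \<in> carrier M" "c \<in> carrier M" "d \<in> carrier M"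
  shows "op_pair R M \<mu> \<nu> (tens R D D (tens R M M a b) (tens R M M c d)) = tens R M M (\<mu> a c) (\<nu> b d)"
proof -
  note lift = tensor_lift_hom[OF M M M]
  show ?thesis
    unfolding op_pair_def comp_def
    by (simp add: tau23_tens assms tensor_map_tens[OF mod_D mod_D M M lift lift] tens_closed[OF M M]
        tensor_lift_tens[OF M M M])
qed

end

section \<open>Sums over multisets\<close>

text \<open>The additive map from multisets induced by \<open>g\<close>, with multiplicities acting
  as natural multiples. Structure constants reach an arbitrary coefficient ring in this way.\<close>

definition msum :: "('a, 'p) ring_scheme \<Rightarrow> ('s \<Rightarrow> 'a) \<Rightarrow> 's multiset \<Rightarrow> 'a" where
  "msum P g A = (\<Oplus>\<^bsub>P\<^esub>s\<in>set_mset A. [count A s] \<cdot>\<^bsub>P\<^esub> g s)"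

context abelian_group
begin

lemma msum_closed:
  assumes "\<And>s. s \<in># A \<Longrightarrow> g s \<in> carrier G"
  shows "msum G g A \<in> carrier G"
  unfolding msum_def using assms by (intro finsum_closed) auto

lemma msum_cong:
  assumes "\<And>s. s \<in># A \<Longrightarrow> g s = h s" "\<And>s. s \<in># A \<Longrightarrow> h s \<in> carrier G"
  shows "msum G g A = msum G h A"
  unfolding msum_def using assms by (intro finsum_cong) (auto simp: simp_implies_def)

lemma msum_empty [simp]: "msum G g {#} = \<zero>"
  by (simp add: msum_def)

lemma msum_single [simp]: "g s \<in> carrier G \<Longrightarrow> msum G g {#s#} = g s"
  by (simp add: msum_def)

lemma msum_union [simp]:
  assumes "\<And>s. g s \<in> carrier G"
  shows "msum G g (A + B) = msum G g A \<oplus> msum G g B"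
proof -
  let ?S = "set_mset A \<union> set_mset B"
  have ext: "msum G g C = (\<Oplus>s\<in>?S. [count C s] \<cdot> g s)" if "set_mset C \<subseteq> ?S" for C
    unfolding msum_def
    by (rule add.finprod_mono_neutral_cong_left) (use that assms in \<open>auto simp: not_in_iff\<close>)
  have "msum G g (A + B) = (\<Oplus>s\<in>?S. [count A s] \<cdot> g s \<oplus> [count B s] \<cdot> g s)"
    using assms by (simp add: ext add.nat_pow_mult)
  also have "\<dots> = msum G g A \<oplus> msum G g B"
    using assms by (simp add: ext finsum_addf)
  finally show ?thesis .
qed

lemma msum_zero [simp]: "msum G (\<lambda>s. \<zero>) A = \<zero>"
  by (induction A rule: mset_additive_induct) simp_all

lemma msum_filter:
  assumes "\<And>s. g s \<in> carrier G"
  shows "msum G g (filter_mset P A) = msum G (\<lambda>s. if P s then g s else \<zero>) A"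
  using assms by (induction A rule: mset_additive_induct) simp_all

lemma msum_sum_mset:
  assumes "\<And>s. g s \<in> carrier G"
  shows "msum G g (\<Sum>a\<in>#A. f a) = msum G (\<lambda>a. msum G g (f a)) A"
  using assms by (induction A rule: mset_additive_induct) (simp_all add: msum_closed)

end

section \<open>Transport from multisets to modules\<close>

lemma module_hom_msum:
  assumes "module R M" "module R N" "f \<in> module_hom R M N" "\<And>s. g s \<in> carrier M"
  shows "f (msum M g A) = msum N (\<lambda>s. f (g s)) A"
proof -
  interpret M: module R M by fact
  interpret N: module R N by fact
  show ?thesis
    by (induction A rule: mset_additive_induct)
      (simp_all add: module_hom_zero[OF assms(1-3)] module_hom_add[OF assms(3)]
        module_hom_closed[OF assms(3)] assms(4) M.M.msum_closed)
qed

text \<open>If \<open>f\<close> gives the structure constants of \<open>\<beta>\<close> on the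
  families \<open>g\<close> and \<open>h\<close>, then by biadditivity \<open>\<beta>\<close> on
  sums is computed by \<open>mbind2 f\<close>. Identities between multiset operations become
  identities between bilinear maps through this lemma.\<close>

lemma bilinear_map_msum:
  assumes "module R M" "module R N" "module R P" "bilinear_map R M N P \<beta>"
    and "\<And>s. g s \<in> carrier M" "\<And>t. h t \<in> carrier N" "\<And>u. k u \<in> carrier P"
    and "\<And>s t. \<beta> (g s) (h t) = msum P k (f s t)"
  shows "\<beta> (msum M g A) (msum N h B) = msum P k (mbind2 f A B)"
proof -
  interpret M: module R M by fact
  interpret N: module R N by fact
  interpret P: module R P by fact
  note closed = M.M.msum_closed N.M.msum_closed P.M.msum_closed assms(5-7)
  note left = bilinear_map_left[OF assms(4)] and right = bilinear_map_right[OF assms(4)]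
  show ?thesis
  proof (induction A rule: mset_additive_induct)
    case (single s)
    show ?case
      by (induction B rule: mset_additive_induct)
        (simp_all add: closed assms(8) module_hom_zero[OF assms(2,3) right] module_hom_add[OF right])
  qed (simp_all add: closed module_hom_zero[OF assms(1,3) left] module_hom_add[OF left])
qed

definition pair_sum ::
  "('k, 'm) ring_scheme \<Rightarrow> ('k, 'a, 'p) module_scheme \<Rightarrow> ('s \<Rightarrow> 'a) \<Rightarrow> ('s \<times> 's) multiset
     \<Rightarrow> ('a \<times> 'a \<Rightarrow> 'k) set" where
  "pair_sum R M g A = msum (tensor R M M) (\<lambda>p. tens R M M (g (fst p)) (g (snd p))) A"

context
  fixes R :: "('k, 'm) ring_scheme" and M :: "('k, 'a, 'p) module_scheme" and g :: "'s \<Rightarrow> 'a"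
  assumes M: "module R M" and g: "\<And>s. g s \<in> carrier M"
begin

lemma pair_sum_closed: "pair_sum R M g A \<in> carrier (tensor R M M)"
proof -
  interpret D: module R "tensor R M M" using M M by (rule module_tensor)
  show ?thesis
    unfolding pair_sum_def by (rule D.M.msum_closed) (simp add: g tens_closed[OF M M])
qed

lemma pair_sum_single: "pair_sum R M g {#(s, t)#} = tens R M M (g s) (g t)"
proof -
  interpret D: module R "tensor R M M" using M M by (rule module_tensor)
  show ?thesis
    by (simp add: pair_sum_def g tens_closed[OF M M])
qed

lemma pair_sum_union:
  "pair_sum R M g (A + B) = pair_sum R M g A \<oplus>\<^bsub>tensor R M M\<^esub> pair_sum R M g B"
proof -
  interpret D: module R "tensor R M M" using M M by (rule module_tensor)
  show ?thesis
    by (simp add: pair_sum_def g tens_closed[OF M M])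
qed

lemma pair_sum_times: "pair_sum R M g (A \<boxtimes> B) = tens R M M (msum M g A) (msum M g B)"
  unfolding pair_sum_def
proof (rule bilinear_map_msum[OF M M module_tensor[OF M M] tens_bilinear[OF M M], symmetric])
  interpret D: module R "tensor R M M" using M M by (rule module_tensor)
  fix s t
  show "tens R M M (g s) (g t) = msum (tensor R M M) (\<lambda>p. tens R M M (g (fst p)) (g (snd p))) {#(s, t)#}"
    by (simp add: g tens_closed[OF M M])
qed (simp_all add: g tens_closed[OF M M])

lemma module_hom_pair_sum:
  assumes "module R P" "f \<in> module_hom R (tensor R M M) P"
  shows "f (pair_sum R M g A) = msum P (\<lambda>p. f (tens R M M (g (fst p)) (g (snd p)))) A"
  unfolding pair_sum_def
  by (rule module_hom_msum[OF module_tensor[OF M M] assms]) (simp add: g tens_closed[OF M M])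

lemma op_pair_pair_sum:
  assumes "bilinear_map R M M M \<mu>" "bilinear_map R M M M \<nu>"
    and "\<And>s t. \<mu> (g s) (g t) = msum M g (f s t)" "\<And>s t. \<nu> (g s) (g t) = msum M g (f' s t)"
  shows "op_pair R M \<mu> \<nu> (tens R (tensor R M M) (tensor R M M) (pair_sum R M g A) (pair_sum R M g B)) =
    pair_sum R M g (mbind2 (pair_op f f') A B)"
proof -
  note D = module_tensor[OF M M]
  show ?thesis
    unfolding pair_sum_def
  proof (rule bilinear_map_msum[OF D D D op_pair_bilinear[OF M assms(1,2)]])
    fix p q :: "'s \<times> 's"
    show "op_pair R M \<mu> \<nu> (tens R (tensor R M M) (tensor R M M) (tens R M M (g (fst p)) (g (snd p)))
        (tens R M M (g (fst q)) (g (snd q)))) =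
      msum (tensor R M M) (\<lambda>p. tens R M M (g (fst p)) (g (snd p))) (pair_op f f' p q)"
      by (simp add: op_pair_tens[OF M assms(1,2)] g assms(3,4) pair_op_def
          flip: pair_sum_times[unfolded pair_sum_def])
  qed (simp_all add: g tens_closed[OF M M])
qed

end

section \<open>The structure maps of the Loday-Ronco Hopf algebra on the basis\<close>

lemma H_LR_simps [simp]:
  "carrier (H_LR R) = carrier (LR_module R)" "\<zero>\<^bsub>H_LR R\<^esub> = \<zero>\<^bsub>LR_module R\<^esub>"
  "add (H_LR R) = add (LR_module R)" "smult (H_LR R) = smult (LR_module R)"
  "monoid.mult (H_LR R) = LR_mult R" "\<one>\<^bsub>H_LR R\<^esub> = basis_elt R Leaf"
  "comult (H_LR R) = LR_comult R" "counit (H_LR R) = LR_counit R" "vee (H_LR R) = LR_vee R"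
  by (simp_all add: H_LR_def)

text \<open>\<open>H_LR R\<close> and \<open>LR_module R\<close> are different records with the same
  module part. Linear maps, bilinear maps and tensor products see only that part, so all statements
  can be moved to \<open>H_LR R\<close>.\<close>

lemma module_hom_H_LR:
  "module_hom R (H_LR R) P = module_hom R (LR_module R) P"
  "module_hom R P (H_LR R) = module_hom R P (LR_module R)"
  by (simp_all add: module_hom_def)

lemma bilinear_map_H_LR:
  "bilinear_map R (H_LR R) (H_LR R) P = bilinear_map R (LR_module R) (LR_module R) P"
  "bilinear_map R M N (H_LR R) = bilinear_map R M N (LR_module R)"
  by (simp_all add: bilinear_map_def module_hom_H_LR fun_eq_iff)

lemma tensor_H_LR:
  "tensor R (LR_module R) (LR_module R) = tensor R (H_LR R) (H_LR R)"
  "tens R (LR_module R) (LR_module R) = tens R (H_LR R) (H_LR R)"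
  by (simp_all add: tensor_def tens_def tensor_ker_def tensor_rels_def fun_eq_iff)

lemma lin_ext_H_LR: "lin_ext R (LR_module R) = lin_ext R (H_LR R)"
  by (simp add: lin_ext_def finsum_def finprod_def fun_eq_iff)

lemma op_pair_H_LR: "op_pair R (LR_module R) = op_pair R (H_LR R)"
  by (simp add: op_pair_def tau23_def tensor_map_def tensor_lift_def tensor_H_LR lin_ext_H_LR fun_eq_iff)

lemma LR_tree_comult_Node:
  "LR_tree_comult R (Node l r) =
     tens R (H_LR R) (H_LR R) (basis_elt R (Node l r)) (basis_elt R Leaf) \<oplus>\<^bsub>tensor R (H_LR R) (H_LR R)\<^esub>
     op_pair R (H_LR R) (LR_mult R) (LR_vee R)
       (tens R (tensor R (H_LR R) (H_LR R)) (tensor R (H_LR R) (H_LR R)) (LR_tree_comult R l) (LR_tree_comult R r))"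
  by (simp add: Let_def tensor_H_LR op_pair_H_LR)

context cring
begin

lemma module_regular_module: "module R (regular_module R)"
  unfolding regular_module_def
  by (intro moduleI abelian_groupI cring_axioms) (auto simp: a_ac l_distr r_distr m_assoc intro: l_neg)

lemma module_H_LR: "module R (H_LR R)"
proof -
  interpret F: module R "LR_module R" by (rule module_free_module)
  show ?thesis
    by (rule moduleI[OF cring_axioms abelian_groupI])
      (auto simp: F.smult_l_distr F.smult_r_distr F.smult_assoc1 intro: F.M.a_ac F.M.add.l_inv_ex)
qed

lemma tree_closed [simp]: "basis_elt R T \<in> carrier (H_LR R)" for T :: pbtree
  by simp

lemma H_LR_hom_eqI:
  assumes "module R P" "h \<in> module_hom R (H_LR R) P" "k \<in> module_hom R (H_LR R) P"
    and "\<And>T. h (basis_elt R T) = k (basis_elt R T)" "x \<in> carrier (H_LR R)"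
  shows "h x = k x"
  by (rule module_hom_free_eqI[OF assms(1) assms(2,3)[unfolded module_hom_H_LR(1)] assms(4)])
    (use assms(5) in simp)

lemma H_LR_bilinear_eqI:
  assumes "module R P" "bilinear_map R (H_LR R) (H_LR R) P \<beta>" "bilinear_map R (H_LR R) (H_LR R) P \<gamma>"
    and "\<And>S T. \<beta> (basis_elt R S) (basis_elt R T) = \<gamma> (basis_elt R S) (basis_elt R T)"
    and "x \<in> carrier (H_LR R)" "y \<in> carrier (H_LR R)"
  shows "\<beta> x y = \<gamma> x y"
  by (rule bilinear_map_free_eqI[OF assms(1) assms(2,3)[unfolded bilinear_map_H_LR(1)] assms(4)])
    (use assms(5,6) in simp_all)

abbreviation tree_sum :: "pbtree multiset \<Rightarrow> pbtree \<Rightarrow> 'a" where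
  "tree_sum \<equiv> msum (H_LR R) (basis_elt R)"

lemma tree_sum_closed [simp]: "tree_sum A \<in> carrier (LR_module R)"
proof -
  interpret H: module R "H_LR R" by (rule module_H_LR)
  show ?thesis using H.M.msum_closed[of A "basis_elt R"] by simp
qed

lemma tree_sum_single [simp]: "tree_sum {#T#} = basis_elt R T"
proof -
  interpret H: module R "H_LR R" by (rule module_H_LR)
  show ?thesis by simp
qed

section \<open>Grafting, product, coproduct and counit on sums of trees\<close>

lemma LR_vee_bilinear: "bilinear_map R (H_LR R) (H_LR R) (H_LR R) (LR_vee R)"
  unfolding LR_vee_def bilinear_map_H_LR by (rule bilin_ext_bilinear[OF module_free_module]) simp

lemma LR_vee_basis [simp]: "LR_vee R (basis_elt R S) (basis_elt R T) = basis_elt R (Node S T)"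
  unfolding LR_vee_def by (rule bilin_ext_basis[OF module_free_module]) auto

lemma LR_vee_tree_sum: "LR_vee R (tree_sum A) (tree_sum B) = tree_sum (A \<curlyvee> B)"
  by (rule bilinear_map_msum[OF module_H_LR module_H_LR module_H_LR LR_vee_bilinear]) simp_all

text \<open>Both recursions have the same shape, and \<open>LR_vee\<close> acts on sums of trees as
  grafting of multisets.\<close>

lemma LR_tree_mult_eq: "LR_tree_mult R S T = tree_sum (tree_mult S T)"
proof (induction S T rule: tree_mult.induct)
  case (3 l r l' r')
  interpret H: module R "H_LR R" by (rule module_H_LR)
  have "LR_vee R (basis_elt R l) (tree_sum A) = tree_sum ({#l#} \<curlyvee> A)"
    "LR_vee R (tree_sum A) (basis_elt R r') = tree_sum (A \<curlyvee> {#r'#})" for A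
    using LR_vee_tree_sum[of "{#l#}" A] LR_vee_tree_sum[of A "{#r'#}"] by simp_all
  with 3 show ?case
    using H.M.msum_union[of "basis_elt R"] by (simp add: tree_mult_Node_Node del: tree_mult.simps)
qed simp_all

lemma LR_mult_bilinear: "bilinear_map R (H_LR R) (H_LR R) (H_LR R) (LR_mult R)"
  unfolding LR_mult_def bilinear_map_H_LR
  by (rule bilin_ext_bilinear[OF module_free_module]) (simp add: LR_tree_mult_eq)

lemma LR_mult_basis: "LR_mult R (basis_elt R S) (basis_elt R T) = tree_sum (tree_mult S T)"
  unfolding LR_mult_def
  by (subst bilin_ext_basis[OF module_free_module, of UNIV UNIV]) (simp_all add: LR_tree_mult_eq)

lemma LR_mult_tree_sum: "LR_mult R (tree_sum A) (tree_sum B) = tree_sum (A \<star> B)"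
  by (rule bilinear_map_msum[OF module_H_LR module_H_LR module_H_LR LR_mult_bilinear])
    (simp_all add: LR_mult_basis)

abbreviation tree_pair_sum :: "(pbtree \<times> pbtree) multiset \<Rightarrow> ((pbtree \<Rightarrow> 'a) \<times> (pbtree \<Rightarrow> 'a) \<Rightarrow> 'a) set" where
  "tree_pair_sum \<equiv> pair_sum R (H_LR R) (basis_elt R)"

lemmas tree_pair_sum_closed [simp] = pair_sum_closed[OF module_H_LR tree_closed]
  and tree_pair_sum_union = pair_sum_union[OF module_H_LR tree_closed]
  and tree_pair_sum_single = pair_sum_single[OF module_H_LR tree_closed]
  and tree_pair_sum_hom = module_hom_pair_sum[OF module_H_LR tree_closed]

lemma op_pair_mult_vee:
  "op_pair R (H_LR R) (LR_mult R) (LR_vee R)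
     (tens R (tensor R (H_LR R) (H_LR R)) (tensor R (H_LR R) (H_LR R)) (tree_pair_sum A) (tree_pair_sum B)) =
   tree_pair_sum (A \<curlyvee>\<^sub>2 B)"
  by (rule op_pair_pair_sum[OF module_H_LR tree_closed LR_mult_bilinear LR_vee_bilinear])
    (simp_all add: LR_mult_basis)

lemma op_pair_mult_mult:
  "op_pair R (H_LR R) (LR_mult R) (LR_mult R)
     (tens R (tensor R (H_LR R) (H_LR R)) (tensor R (H_LR R) (H_LR R)) (tree_pair_sum A) (tree_pair_sum B)) =
   tree_pair_sum (A \<star>\<^sub>2 B)"
  by (rule op_pair_pair_sum[OF module_H_LR tree_closed LR_mult_bilinear LR_mult_bilinear])
    (simp_all add: LR_mult_basis)

lemma LR_tree_comult_eq: "LR_tree_comult R T = tree_pair_sum (tree_comult T)"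
proof (induction T)
  case Leaf
  show ?case by (simp add: tensor_H_LR tree_pair_sum_single)
next
  case (Node l r)
  then show ?case
    by (simp only: LR_tree_comult_Node op_pair_mult_vee tree_comult.simps tree_pair_sum_union tree_pair_sum_single)
qed

lemma module_H_LR_tensor: "module R (tensor R (H_LR R) (H_LR R))"
  by (rule module_tensor[OF module_H_LR module_H_LR])

lemma LR_comult_hom: "LR_comult R \<in> module_hom R (H_LR R) (tensor R (H_LR R) (H_LR R))"
  unfolding LR_comult_def module_hom_H_LR tensor_H_LR
  by (rule lin_ext_hom[OF module_H_LR_tensor]) (simp add: LR_tree_comult_eq)

lemma LR_comult_basis: "LR_comult R (basis_elt R T) = tree_pair_sum (tree_comult T)"
  unfolding LR_comult_def module_hom_H_LR tensor_H_LR
  by (subst lin_ext_basis[OF module_H_LR_tensor, of _ UNIV]) (simp_all add: LR_tree_comult_eq)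

lemma LR_comult_tree_sum: "LR_comult R (tree_sum A) = tree_pair_sum (mcomult A)"
proof -
  interpret D: module R "tensor R (H_LR R) (H_LR R)" by (rule module_H_LR_tensor)
  show ?thesis
    by (subst module_hom_msum[OF module_H_LR module_H_LR_tensor LR_comult_hom])
      (simp_all add: LR_comult_basis pair_sum_def D.M.msum_sum_mset tens_closed[OF module_H_LR module_H_LR])
qed

lemma LR_counit_hom: "LR_counit R \<in> module_hom R (H_LR R) (regular_module R)"
  unfolding LR_counit_def module_hom_H_LR
  by (rule lin_ext_hom[OF module_regular_module]) (auto simp: regular_module_def split: pbtree.splits)

lemma LR_counit_basis: "LR_counit R (basis_elt R T) = (if T = Leaf then \<one> else \<zero>)"
  unfolding LR_counit_def
  by (subst lin_ext_basis[OF module_regular_module, of _ UNIV])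
    (auto simp: regular_module_def split: pbtree.splits)

section \<open>Algebra and grafting axioms\<close>

lemma LR_mult_closed: "x \<in> carrier (LR_module R) \<Longrightarrow> y \<in> carrier (LR_module R) \<Longrightarrow> LR_mult R x y \<in> carrier (LR_module R)"
  using bilinear_map_closed[OF LR_mult_bilinear] by simp

lemma LR_mult_assoc:
  assumes "x \<in> carrier (H_LR R)" "y \<in> carrier (H_LR R)" "z \<in> carrier (H_LR R)"
  shows "LR_mult R (LR_mult R x y) z = LR_mult R x (LR_mult R y z)"
proof (rule H_LR_hom_eqI[OF module_H_LR _ _ _ assms(1)])
  note left = bilinear_map_left[OF LR_mult_bilinear] and right = bilinear_map_right[OF LR_mult_bilinear]
  show "(\<lambda>x. LR_mult R (LR_mult R x y) z) \<in> module_hom R (H_LR R) (H_LR R)"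
    by (intro module_hom_compose[OF left[OF assms(2)] left[OF assms(3)]])
  show "(\<lambda>x. LR_mult R x (LR_mult R y z)) \<in> module_hom R (H_LR R) (H_LR R)"
    using assms by (intro left) (simp add: LR_mult_closed)
  fix S
  show "LR_mult R (LR_mult R (basis_elt R S) y) z = LR_mult R (basis_elt R S) (LR_mult R y z)"
  proof (rule H_LR_bilinear_eqI[OF module_H_LR _ _ _ assms(2,3)])
    show "bilinear_map R (H_LR R) (H_LR R) (H_LR R) (\<lambda>y z. LR_mult R (LR_mult R (basis_elt R S) y) z)"
      by (rule bilinear_map_compose[OF LR_mult_bilinear right module_hom_id]) simp
    show "bilinear_map R (H_LR R) (H_LR R) (H_LR R) (\<lambda>y z. LR_mult R (basis_elt R S) (LR_mult R y z))"
      by (rule module_hom_bilinear_map[OF LR_mult_bilinear right]) simp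
    fix T U
    have "LR_mult R (LR_mult R (tree_sum {#S#}) (tree_sum {#T#})) (tree_sum {#U#}) =
      LR_mult R (tree_sum {#S#}) (LR_mult R (tree_sum {#T#}) (tree_sum {#U#}))"
      by (simp only: LR_mult_tree_sum mmult_assoc)
    then show "LR_mult R (LR_mult R (basis_elt R S) (basis_elt R T)) (basis_elt R U) =
      LR_mult R (basis_elt R S) (LR_mult R (basis_elt R T) (basis_elt R U))"
      by simp
  qed
qed

lemma LR_mult_Leaf:
  assumes "x \<in> carrier (H_LR R)"
  shows "LR_mult R (basis_elt R Leaf) x = x" "LR_mult R x (basis_elt R Leaf) = x"
proof -
  show "LR_mult R (basis_elt R Leaf) x = x"
    by (rule H_LR_hom_eqI[OF module_H_LR bilinear_map_right[OF LR_mult_bilinear] module_hom_id _ assms])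
      (simp_all add: LR_mult_basis)
  show "LR_mult R x (basis_elt R Leaf) = x"
    by (rule H_LR_hom_eqI[OF module_H_LR bilinear_map_left[OF LR_mult_bilinear] module_hom_id _ assms])
      (simp_all add: LR_mult_basis)
qed

lemma unital_algebra_H_LR: "unital_algebra R (H_LR R)"
proof -
  interpret H: module R "H_LR R" by (rule module_H_LR)
  note left = bilinear_map_left[OF LR_mult_bilinear] and right = bilinear_map_right[OF LR_mult_bilinear]
  have "ring (H_LR R)"
    by (rule ringI)
      (use H.M.abelian_group_axioms module_hom_add[OF left] module_hom_add[OF right] in
        \<open>auto simp: LR_mult_closed LR_mult_assoc LR_mult_Leaf intro!: monoidI\<close>)
  then show ?thesis
    using module_H_LR module_hom_smult[OF left] module_hom_smult[OF right]
    by (intro unital_algebra.intro unital_algebra_axioms.intro) auto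
qed

lemma vee_algebra_H_LR: "vee_algebra R (H_LR R) (LR_vee R)"
proof (intro vee_algebra.intro vee_algebra_axioms.intro unital_algebra_H_LR LR_vee_bilinear)
  interpret H: module R "H_LR R" by (rule module_H_LR)
  note vleft = bilinear_map_left[OF LR_vee_bilinear] and vright = bilinear_map_right[OF LR_vee_bilinear]
  note mleft = bilinear_map_left[OF LR_mult_bilinear] and mright = bilinear_map_right[OF LR_mult_bilinear]
  note plus = module_hom_plus[OF module_H_LR module_H_LR]
  note compose = module_hom_compose[where N = "H_LR R"]
  have closed: "LR_mult R x y \<in> carrier (H_LR R)" "LR_vee R x y \<in> carrier (H_LR R)"
    if "x \<in> carrier (H_LR R)" "y \<in> carrier (H_LR R)" for x y
    using that bilinear_map_closed[OF LR_mult_bilinear] bilinear_map_closed[OF LR_vee_bilinear] by blast+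
  fix a1 a2 b1 b2
  assume *: "a1 \<in> carrier (H_LR R)" "a2 \<in> carrier (H_LR R)" "b1 \<in> carrier (H_LR R)" "b2 \<in> carrier (H_LR R)"
  \<comment> \<open>On trees the law is the image of \<open>mmult_mgraft\<close>; the nested
    arguments below replace the four variables by trees one at a time.\<close>
  have basis: "LR_mult R (LR_vee R (basis_elt R S) (basis_elt R T)) (LR_vee R (basis_elt R U) (basis_elt R V)) =
    LR_vee R (basis_elt R S) (LR_mult R (basis_elt R T) (LR_vee R (basis_elt R U) (basis_elt R V))) \<oplus>\<^bsub>H_LR R\<^esub>
    LR_vee R (LR_mult R (LR_vee R (basis_elt R S) (basis_elt R T)) (basis_elt R U)) (basis_elt R V)" for S T U V
  proof -
    have "LR_mult R (LR_vee R (tree_sum {#S#}) (tree_sum {#T#})) (LR_vee R (tree_sum {#U#}) (tree_sum {#V#})) =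
    LR_vee R (tree_sum {#S#}) (LR_mult R (tree_sum {#T#}) (LR_vee R (tree_sum {#U#}) (tree_sum {#V#}))) \<oplus>\<^bsub>H_LR R\<^esub>
    LR_vee R (LR_mult R (LR_vee R (tree_sum {#S#}) (tree_sum {#T#})) (tree_sum {#U#})) (tree_sum {#V#})"
      by (simp only: LR_mult_tree_sum LR_vee_tree_sum mmult_mgraft H.M.msum_union tree_closed)
    then show ?thesis by (simp only: tree_sum_single)
  qed
  have "LR_mult R (LR_vee R a1 a2) (LR_vee R b1 b2) =
    LR_vee R a1 (LR_mult R a2 (LR_vee R b1 b2)) \<oplus>\<^bsub>H_LR R\<^esub> LR_vee R (LR_mult R (LR_vee R a1 a2) b1) b2"
  proof (rule H_LR_hom_eqI[OF module_H_LR _ plus _ *(1)])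
    show "(\<lambda>x. LR_mult R (LR_vee R x a2) (LR_vee R b1 b2)) \<in> module_hom R (H_LR R) (H_LR R)"
      using * by (intro compose[OF vleft mleft] closed)
    show "(\<lambda>x. LR_vee R x (LR_mult R a2 (LR_vee R b1 b2))) \<in> module_hom R (H_LR R) (H_LR R)"
      using * by (intro vleft closed)
    show "(\<lambda>x. LR_vee R (LR_mult R (LR_vee R x a2) b1) b2) \<in> module_hom R (H_LR R) (H_LR R)"
      using * by (intro compose[OF compose[OF vleft mleft] vleft] closed)
    fix S
    show "LR_mult R (LR_vee R (basis_elt R S) a2) (LR_vee R b1 b2) =
      LR_vee R (basis_elt R S) (LR_mult R a2 (LR_vee R b1 b2)) \<oplus>\<^bsub>H_LR R\<^esub>
      LR_vee R (LR_mult R (LR_vee R (basis_elt R S) a2) b1) b2"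
    proof (rule H_LR_hom_eqI[OF module_H_LR _ plus _ *(2)])
      show "(\<lambda>x. LR_mult R (LR_vee R (basis_elt R S) x) (LR_vee R b1 b2)) \<in> module_hom R (H_LR R) (H_LR R)"
        using * by (intro compose[OF vright mleft] closed tree_closed)
      show "(\<lambda>x. LR_vee R (basis_elt R S) (LR_mult R x (LR_vee R b1 b2))) \<in> module_hom R (H_LR R) (H_LR R)"
        using * by (intro compose[OF mleft vright] closed tree_closed)
      show "(\<lambda>x. LR_vee R (LR_mult R (LR_vee R (basis_elt R S) x) b1) b2) \<in> module_hom R (H_LR R) (H_LR R)"
        using * by (intro compose[OF compose[OF vright mleft] vleft] closed tree_closed)
      fix T
      let ?v = "LR_vee R (basis_elt R S) (basis_elt R T)"
      show "LR_mult R ?v (LR_vee R b1 b2) =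
        LR_vee R (basis_elt R S) (LR_mult R (basis_elt R T) (LR_vee R b1 b2)) \<oplus>\<^bsub>H_LR R\<^esub>
        LR_vee R (LR_mult R ?v b1) b2"
      proof (rule H_LR_hom_eqI[OF module_H_LR _ plus _ *(3)])
        show "(\<lambda>x. LR_mult R ?v (LR_vee R x b2)) \<in> module_hom R (H_LR R) (H_LR R)"
          using * by (intro compose[OF vleft mright] closed tree_closed)
        show "(\<lambda>x. LR_vee R (basis_elt R S) (LR_mult R (basis_elt R T) (LR_vee R x b2))) \<in> module_hom R (H_LR R) (H_LR R)"
          using * by (intro compose[OF compose[OF vleft mright] vright] closed tree_closed)
        show "(\<lambda>x. LR_vee R (LR_mult R ?v x) b2) \<in> module_hom R (H_LR R) (H_LR R)"
          using * by (intro compose[OF mright vleft] closed tree_closed)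
        fix U
        show "LR_mult R ?v (LR_vee R (basis_elt R U) b2) =
          LR_vee R (basis_elt R S) (LR_mult R (basis_elt R T) (LR_vee R (basis_elt R U) b2)) \<oplus>\<^bsub>H_LR R\<^esub>
          LR_vee R (LR_mult R ?v (basis_elt R U)) b2"
        proof (rule H_LR_hom_eqI[OF module_H_LR _ plus _ *(4)])
          show "(\<lambda>x. LR_mult R ?v (LR_vee R (basis_elt R U) x)) \<in> module_hom R (H_LR R) (H_LR R)"
            using * by (intro compose[OF vright mright] closed tree_closed)
          show "(\<lambda>x. LR_vee R (basis_elt R S) (LR_mult R (basis_elt R T) (LR_vee R (basis_elt R U) x)))
              \<in> module_hom R (H_LR R) (H_LR R)"
            using * by (intro compose[OF compose[OF vright mright] vright] closed tree_closed)
          show "LR_vee R (LR_mult R ?v (basis_elt R U)) \<in> module_hom R (H_LR R) (H_LR R)"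
            using * by (intro vright closed tree_closed)
        qed (rule basis)
      qed
    qed
  qed
  then show "LR_vee R a1 a2 \<otimes>\<^bsub>H_LR R\<^esub> LR_vee R b1 b2 =
    LR_vee R a1 (a2 \<otimes>\<^bsub>H_LR R\<^esub> LR_vee R b1 b2) \<oplus>\<^bsub>H_LR R\<^esub> LR_vee R (LR_vee R a1 a2 \<otimes>\<^bsub>H_LR R\<^esub> b1) b2"
    by simp
qed

end

section \<open>Convolution\<close>

text \<open>A linear map on the free module is recorded by its values on trees, so convolution
  becomes an operation on functions of trees with values in any ring.\<close>

definition conv ::
  "('a, 'p) ring_scheme \<Rightarrow> (pbtree \<Rightarrow> 'a) \<Rightarrow> (pbtree \<Rightarrow> 'a) \<Rightarrow> pbtree \<Rightarrow> 'a" where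
  "conv A f g T = msum A (\<lambda>p. f (fst p) \<otimes>\<^bsub>A\<^esub> g (snd p)) (tree_comult T)"

text \<open>The unit of convolution, that is, the counit followed by the unit of
  \<open>A\<close>.\<close>

definition conv_one :: "('a, 'p) ring_scheme \<Rightarrow> pbtree \<Rightarrow> 'a" where
  "conv_one A T = (if T = Leaf then \<one>\<^bsub>A\<^esub> else \<zero>\<^bsub>A\<^esub>)"

context ring
begin

lemma msum_ldistr:
  assumes "\<And>s. g s \<in> carrier R" "a \<in> carrier R"
  shows "msum R g A \<otimes> a = msum R (\<lambda>s. g s \<otimes> a) A"
  using assms by (induction A rule: mset_additive_induct) (simp_all add: l_distr msum_closed)

lemma msum_rdistr:
  assumes "\<And>s. g s \<in> carrier R" "a \<in> carrier R"
  shows "a \<otimes> msum R g A = msum R (\<lambda>s. a \<otimes> g s) A"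
  using assms by (induction A rule: mset_additive_induct) (simp_all add: r_distr msum_closed)

lemma conv_one_left:
  assumes "\<And>T. f T \<in> carrier R"
  shows "conv R (conv_one R) f T = f T"
proof -
  have "conv R (conv_one R) f T = msum R (\<lambda>p. if fst p = Leaf then f (snd p) else \<zero>) (tree_comult T)"
    unfolding conv_def using assms by (intro msum_cong) (auto simp: conv_one_def)
  also have "\<dots> = f T"
    using assms by (subst msum_filter[symmetric]) (simp_all add: tree_counit_left)
  finally show ?thesis .
qed

lemma conv_one_right:
  assumes "\<And>T. f T \<in> carrier R"
  shows "conv R f (conv_one R) T = f T"
proof -
  have "conv R f (conv_one R) T = msum R (\<lambda>p. if snd p = Leaf then f (fst p) else \<zero>) (tree_comult T)"
    unfolding conv_def using assms by (intro msum_cong) (auto simp: conv_one_def)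
  also have "\<dots> = f T"
    using assms by (subst msum_filter[symmetric]) (simp_all add: tree_counit_right)
  finally show ?thesis .
qed

text \<open>Both sides sum the triple product over an iterated coproduct, the left one over
  \<open>comult_left\<close> and the right one over \<open>comult_right\<close>; these agree by
  \<open>tree_coassoc\<close>.\<close>

lemma conv_assoc:
  assumes [simp]: "\<And>T. f T \<in> carrier R" "\<And>T. g T \<in> carrier R" "\<And>T. h T \<in> carrier R"
  shows "conv R (conv R f g) h T = conv R f (conv R g h) T"
proof -
  let ?k = "\<lambda>(a, b, c). f a \<otimes> g b \<otimes> h c"
  have k: "?k t \<in> carrier R" for t by (cases t) simp
  have "msum R ?k (reassoc (A \<boxtimes> {#c#})) = msum R (\<lambda>p. f (fst p) \<otimes> g (snd p) \<otimes> h c) A" for A c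
    by (induction A rule: mset_additive_induct) (auto simp: k split: prod.split)
  then have l: "msum R ?k (comult_left A) = msum R (\<lambda>p. conv R f g (fst p) \<otimes> h (snd p)) A" for A
    by (simp add: msum_sum_mset k conv_def msum_ldistr case_prod_beta)
  have "msum R ?k ({#a#} \<boxtimes> A) = msum R (\<lambda>p. f a \<otimes> (g (fst p) \<otimes> h (snd p))) A" for A a
    by (induction A rule: mset_additive_induct) (auto simp: k m_assoc split: prod.split)
  then have r: "msum R ?k (comult_right A) = msum R (\<lambda>p. f (fst p) \<otimes> conv R g h (snd p)) A" for A
    by (simp add: msum_sum_mset k conv_def msum_rdistr case_prod_beta)
  show ?thesis
    using l[of "tree_comult T"] r[of "tree_comult T"]
    by (simp add: tree_coassoc conv_def[of _ "conv R f g"] conv_def[of _ f])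
qed

lemma conv_inverse_unique:
  assumes "\<And>T. f T \<in> carrier R" "\<And>T. g T \<in> carrier R" "\<And>T. h T \<in> carrier R"
    and "conv R f g = conv_one R" "conv R g h = conv_one R"
  shows "f = h"
proof
  fix T
  have "f T = conv R f (conv R g h) T"
    unfolding assms(5) by (rule conv_one_right[symmetric]) (rule assms)
  also have "\<dots> = conv R (conv R f g) h T"
    by (rule conv_assoc[symmetric]; rule assms)
  also have "\<dots> = h T"
    unfolding assms(4) by (rule conv_one_left) (rule assms)
  finally show "f T = h T" .
qed

text \<open>
  The recursion solves \<open>conv L f T = 0\<close> for \<open>L T\<close>: the only term of \<open>\<Delta> T\<close> whose left factor is not
  smaller than \<open>T\<close> is \<open>T \<otimes> |\<close>.
\<close>

lemma conv_left_inverse: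
  assumes f: "\<And>T. f T \<in> carrier R" "f Leaf = \<one>"
  obtains L where "\<And>T. L T \<in> carrier R" "conv R L f = conv_one R" "L Leaf = \<one>"
proof -
  define rest where "rest T = filter_mset (\<lambda>p. snd p \<noteq> Leaf) (tree_comult T)" for T
  define step where "step L T =
    (if T = Leaf then \<one> else \<ominus> msum R (\<lambda>p. L (fst p) \<otimes> f (snd p)) (rest T))" for L T
  define L where "L = wfrec (measure size) step"
  have smaller: "size (fst p) < size T" if "p \<in># rest T" for p T
    using that size_tree_comult[of p T] by (cases "snd p") (auto simp: rest_def)
  have L_rec: "L T = step (cut L (measure size) T) T" for T
    unfolding L_def by (rule wfrec) simp
  have closed: "L T \<in> carrier R" for T
  proof (induction "size T" arbitrary: T rule: less_induct)
    case less
    have "msum R (\<lambda>p. cut L (measure size) T (fst p) \<otimes> f (snd p)) (rest T) \<in> carrier R"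
      using smaller[of _ T] less f by (intro msum_closed) (simp add: cut_apply)
    then show ?case by (subst L_rec) (simp add: step_def)
  qed
  have L: "L T = step L T" for T
  proof -
    have "msum R (\<lambda>p. cut L (measure size) T (fst p) \<otimes> f (snd p)) (rest T) =
      msum R (\<lambda>p. L (fst p) \<otimes> f (snd p)) (rest T)"
      using smaller[of _ T] closed f by (intro msum_cong) (simp_all add: cut_apply)
    then show ?thesis by (subst L_rec) (simp add: step_def)
  qed
  have "conv R L f T = conv_one R T" for T
  proof (cases T)
    case Leaf
    then show ?thesis using L[of Leaf] f by (simp add: conv_def conv_one_def step_def)
  next
    case (Node l r)
    have "tree_comult T = {#(T, Leaf)#} + rest T"
      using multiset_partition[of "tree_comult T" "\<lambda>p. snd p = Leaf"] by (simp add: rest_def tree_counit_right)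
    then have "conv R L f T = L T \<oplus> msum R (\<lambda>p. L (fst p) \<otimes> f (snd p)) (rest T)"
      using msum_union[of "\<lambda>p. L (fst p) \<otimes> f (snd p)" "{#(T, Leaf)#}" "rest T"] closed f by (simp add: conv_def)
    moreover have "L T = \<ominus> msum R (\<lambda>p. L (fst p) \<otimes> f (snd p)) (rest T)"
      using Node by (subst L) (simp add: step_def)
    ultimately show ?thesis
      using Node closed f by (simp add: conv_one_def l_neg msum_closed)
  qed
  then show ?thesis
    using that[of L] closed L[of Leaf] by (auto simp: step_def)
qed

text \<open>The left inverse \<open>L\<close> also takes the value one at \<open>Leaf\<close>, so it
  has a left inverse \<open>L'\<close> of its own. Then \<open>L'\<close> and \<open>f\<close> are a
  left and a right inverse of \<open>L\<close> and coincide, which makes \<open>L\<close>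
  two-sided.\<close>

lemma conv_inverse:
  assumes f: "\<And>T. f T \<in> carrier R" "f Leaf = \<one>"
  obtains L where "\<And>T. L T \<in> carrier R" "conv R L f = conv_one R" "conv R f L = conv_one R"
proof -
  obtain L where L: "\<And>T. L T \<in> carrier R" "conv R L f = conv_one R" "L Leaf = \<one>"
    by (rule conv_left_inverse[of f, OF f]) auto
  obtain L' where L': "\<And>T. L' T \<in> carrier R" "conv R L' L = conv_one R" "L' Leaf = \<one>"
    by (rule conv_left_inverse[of L, OF L(1,3)]) auto
  have "L' = f" using L'(1) L(1) f(1) L'(2) L(2) by (rule conv_inverse_unique)
  then show ?thesis using that L L' by blast
qed

end

section \<open>The bialgebra axioms\<close>

context cring
begin

lemma bilinear_map_regular_mult: "bilinear_map R (regular_module R) (regular_module R) (regular_module R) (\<otimes>)"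
  by (intro bilinear_mapI module_homI) (auto simp: regular_module_def l_distr r_distr m_ac)

lemma LR_coassoc:
  assumes "x \<in> carrier (H_LR R)"
  shows "tensor_assoc R (H_LR R) (H_LR R) (H_LR R)
      (tensor_map R (tensor R (H_LR R) (H_LR R)) (H_LR R) (LR_comult R) (\<lambda>y. y) (LR_comult R x)) =
    tensor_map R (H_LR R) (tensor R (H_LR R) (H_LR R)) (\<lambda>y. y) (LR_comult R) (LR_comult R x)"
    (is "?l x = ?r x")
proof (rule H_LR_hom_eqI[OF _ _ _ _ assms])
  let ?H = "H_LR R" and ?D = "tensor R (H_LR R) (H_LR R)"
  let ?HD = "tensor R ?H ?D"
  note H = module_H_LR and D = module_H_LR_tensor
  have HD: "module R ?HD" by (rule module_tensor[OF H D])
  interpret HD: module R ?HD by (rule HD)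
  note left = tensor_map_hom[OF H H D H LR_comult_hom module_hom_id]
  note right = tensor_map_hom[OF H H H D module_hom_id LR_comult_hom]
  note assoc = module_hom_compose[OF left tensor_assoc_hom[OF H H H]]
  show "module R ?HD" by (rule HD)
  show "?l \<in> module_hom R ?H ?HD" by (rule module_hom_compose[OF LR_comult_hom assoc])
  show "?r \<in> module_hom R ?H ?HD" by (rule module_hom_compose[OF LR_comult_hom right])
  fix T
  let ?e = "basis_elt R :: pbtree \<Rightarrow> _"
  \<comment> \<open>Both sides are compared as sums of \<open>?k\<close> over multisets of triples,
    where \<open>tree_coassoc\<close> applies.\<close>
  let ?k = "\<lambda>(a, b, c). tens R ?H ?D (?e a) (tens R ?H ?H (?e b) (?e c))"
  have k: "?k t \<in> carrier ?HD" for t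
    by (cases t) (simp add: tens_closed[OF H D] tens_closed[OF H H])
  have "tensor_assoc R ?H ?H ?H (tens R ?D ?H (tree_pair_sum A) (?e c)) = msum ?HD ?k (reassoc (A \<boxtimes> {#c#}))" for A c
  proof -
    have "(\<lambda>X. tensor_assoc R ?H ?H ?H (tens R ?D ?H X (?e c))) \<in> module_hom R ?D ?HD"
      by (rule module_hom_compose[OF bilinear_map_left[OF tens_bilinear[OF D H]] tensor_assoc_hom[OF H H H]]) simp
    from tree_pair_sum_hom[OF HD this]
    have "tensor_assoc R ?H ?H ?H (tens R ?D ?H (tree_pair_sum A) (?e c)) = msum ?HD (\<lambda>p. ?k (fst p, snd p, c)) A"
      by (simp add: tensor_assoc_tens[OF H H H])
    also have "\<dots> = msum ?HD ?k (reassoc (A \<boxtimes> {#c#}))"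
      by (induction A rule: mset_additive_induct) (auto simp: tens_closed[OF H D] tens_closed[OF H H] k split: prod.split)
    finally show ?thesis .
  qed
  then have "?l (?e T) = msum ?HD ?k (comult_left (tree_comult T))"
    by (simp add: LR_comult_basis tree_pair_sum_hom[OF HD assoc] tensor_map_tens[OF H H D H LR_comult_hom module_hom_id]
        HD.M.msum_sum_mset[of ?k, OF k] case_prod_beta[of "\<lambda>a b. reassoc (tree_comult a \<boxtimes> {#b#})"]
        case_prod_beta[of "\<lambda>a b. {#a#} \<boxtimes> tree_comult b"])
  moreover have "tens R ?H ?D (?e a) (tree_pair_sum A) = msum ?HD ?k ({#a#} \<boxtimes> A)" for A a
  proof -
    have "tens R ?H ?D (?e a) (tree_pair_sum A) = msum ?HD (\<lambda>p. ?k (a, p)) A"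
      by (subst tree_pair_sum_hom[OF HD bilinear_map_right[OF tens_bilinear[OF H D]]]) (simp_all add: case_prod_beta)
    also have "\<dots> = msum ?HD ?k ({#a#} \<boxtimes> A)"
      by (induction A rule: mset_additive_induct) (auto simp: k k[of "(a, p)" for p, unfolded split_conv] tens_closed[OF H D] tens_closed[OF H H] split: prod.split)
    finally show ?thesis .
  qed
  then have "?r (?e T) = msum ?HD ?k (comult_right (tree_comult T))"
    by (simp add: LR_comult_basis tree_pair_sum_hom[OF HD right] tensor_map_tens[OF H H H D module_hom_id LR_comult_hom]
        HD.M.msum_sum_mset[of ?k, OF k] case_prod_beta[of "\<lambda>a b. reassoc (tree_comult a \<boxtimes> {#b#})"]
        case_prod_beta[of "\<lambda>a b. {#a#} \<boxtimes> tree_comult b"])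
  ultimately show "?l (?e T) = ?r (?e T)" by (simp only: tree_coassoc)
qed

lemma bilinear_map_counit:
  "bilinear_map R (H_LR R) (H_LR R) (H_LR R) (\<lambda>a b. LR_counit R a \<odot>\<^bsub>H_LR R\<^esub> b)"
  "bilinear_map R (H_LR R) (H_LR R) (H_LR R) (\<lambda>a b. LR_counit R b \<odot>\<^bsub>H_LR R\<^esub> a)"
  using bilinear_map_smult[OF module_H_LR module_H_LR LR_counit_hom] by (auto simp: bilinear_map_def)

text \<open>On a tree, the counit kills every coproduct term whose left factor is a node, and
  \<open>tree_counit_left\<close> identifies the one that is left.\<close>

lemma LR_counit_left:
  assumes "x \<in> carrier (H_LR R)"
  shows "tensor_lift R (H_LR R) (\<lambda>a b. LR_counit R a \<odot>\<^bsub>H_LR R\<^esub> b) (LR_comult R x) = x"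
proof (rule H_LR_hom_eqI[OF module_H_LR _ module_hom_id _ assms])
  interpret H: module R "H_LR R" by (rule module_H_LR)
  note H = module_H_LR
  note lift = tensor_lift_hom[OF H H H bilinear_map_counit(1)]
  show "(\<lambda>x. tensor_lift R (H_LR R) (\<lambda>a b. LR_counit R a \<odot>\<^bsub>H_LR R\<^esub> b) (LR_comult R x)) \<in> module_hom R (H_LR R) (H_LR R)"
    by (rule module_hom_compose[OF LR_comult_hom lift])
  fix T
  have "tensor_lift R (H_LR R) (\<lambda>a b. LR_counit R a \<odot>\<^bsub>H_LR R\<^esub> b) (LR_comult R (basis_elt R T)) =
    msum (H_LR R) (\<lambda>p. LR_counit R (basis_elt R (fst p)) \<odot>\<^bsub>H_LR R\<^esub> basis_elt R (snd p)) (tree_comult T)"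
    using tree_pair_sum_hom[OF H lift] tensor_lift_tens[OF H H H bilinear_map_counit(1)] by (simp add: LR_comult_basis)
  also have "\<dots> = msum (H_LR R) (\<lambda>p. if fst p = Leaf then basis_elt R (snd p) else \<zero>\<^bsub>H_LR R\<^esub>) (tree_comult T)"
    by (rule H.M.msum_cong) (use H.smult_one[OF tree_closed] H.smult_l_null[OF tree_closed] H.M.zero_closed in \<open>auto simp: LR_counit_basis\<close>)
  also have "\<dots> = basis_elt R T"
    by (subst H.M.msum_filter[symmetric]) (simp_all add: tree_counit_left)
  finally show "tensor_lift R (H_LR R) (\<lambda>a b. LR_counit R a \<odot>\<^bsub>H_LR R\<^esub> b) (LR_comult R (basis_elt R T)) = basis_elt R T" .
qed

lemma LR_counit_right:
  assumes "x \<in> carrier (H_LR R)"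
  shows "tensor_lift R (H_LR R) (\<lambda>a b. LR_counit R b \<odot>\<^bsub>H_LR R\<^esub> a) (LR_comult R x) = x"
proof (rule H_LR_hom_eqI[OF module_H_LR _ module_hom_id _ assms])
  interpret H: module R "H_LR R" by (rule module_H_LR)
  note H = module_H_LR
  note lift = tensor_lift_hom[OF H H H bilinear_map_counit(2)]
  show "(\<lambda>x. tensor_lift R (H_LR R) (\<lambda>a b. LR_counit R b \<odot>\<^bsub>H_LR R\<^esub> a) (LR_comult R x)) \<in> module_hom R (H_LR R) (H_LR R)"
    by (rule module_hom_compose[OF LR_comult_hom lift])
  fix T
  have "tensor_lift R (H_LR R) (\<lambda>a b. LR_counit R b \<odot>\<^bsub>H_LR R\<^esub> a) (LR_comult R (basis_elt R T)) =
    msum (H_LR R) (\<lambda>p. LR_counit R (basis_elt R (snd p)) \<odot>\<^bsub>H_LR R\<^esub> basis_elt R (fst p)) (tree_comult T)"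
    using tree_pair_sum_hom[OF H lift] tensor_lift_tens[OF H H H bilinear_map_counit(2)] by (simp add: LR_comult_basis)
  also have "\<dots> = msum (H_LR R) (\<lambda>p. if snd p = Leaf then basis_elt R (fst p) else \<zero>\<^bsub>H_LR R\<^esub>) (tree_comult T)"
    by (rule H.M.msum_cong) (use H.smult_one[OF tree_closed] H.smult_l_null[OF tree_closed] H.M.zero_closed in \<open>auto simp: LR_counit_basis\<close>)
  also have "\<dots> = basis_elt R T"
    by (subst H.M.msum_filter[symmetric]) (simp_all add: tree_counit_right)
  finally show "tensor_lift R (H_LR R) (\<lambda>a b. LR_counit R b \<odot>\<^bsub>H_LR R\<^esub> a) (LR_comult R (basis_elt R T)) = basis_elt R T" .
qed

lemma LR_comult_mult:
  assumes "x \<in> carrier (H_LR R)" "y \<in> carrier (H_LR R)"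
  shows "LR_comult R (LR_mult R x y) = op_pair R (H_LR R) (LR_mult R) (LR_mult R)
    (tens R (tensor R (H_LR R) (H_LR R)) (tensor R (H_LR R) (H_LR R)) (LR_comult R x) (LR_comult R y))"
  by (rule H_LR_bilinear_eqI[OF module_H_LR_tensor module_hom_bilinear_map[OF LR_mult_bilinear LR_comult_hom]
      bilinear_map_compose[OF op_pair_bilinear[OF module_H_LR LR_mult_bilinear LR_mult_bilinear] LR_comult_hom LR_comult_hom]
      _ assms])
    (simp only: LR_mult_basis LR_comult_tree_sum LR_comult_basis op_pair_mult_mult tree_comult_mult)

text \<open>On trees, \<open>Leaf\<close> occurs in a product only when both factors are
  \<open>Leaf\<close>; otherwise every term of the product has counit zero.\<close>

lemma LR_counit_mult:
  assumes "x \<in> carrier (H_LR R)" "y \<in> carrier (H_LR R)"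
  shows "LR_counit R (LR_mult R x y) = LR_counit R x \<otimes> LR_counit R y"
proof (rule H_LR_bilinear_eqI[OF module_regular_module module_hom_bilinear_map[OF LR_mult_bilinear LR_counit_hom]
      bilinear_map_compose[OF bilinear_map_regular_mult LR_counit_hom LR_counit_hom] _ assms])
  interpret K: module R "regular_module R" by (rule module_regular_module)
  fix S T
  have "LR_counit R (LR_mult R (basis_elt R S) (basis_elt R T)) =
    msum (regular_module R) (\<lambda>U. LR_counit R (basis_elt R U)) (tree_mult S T)"
    unfolding LR_mult_basis
    by (rule module_hom_msum[OF module_H_LR module_regular_module LR_counit_hom]) simp
  also have "\<dots> = LR_counit R (basis_elt R S) \<otimes> LR_counit R (basis_elt R T)"
  proof (cases "S = Leaf \<and> T = Leaf")
    case True
    then show ?thesis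
      using K.M.msum_single[of "\<lambda>U. LR_counit R (basis_elt R U)" Leaf]
      by (simp add: LR_counit_basis regular_module_def)
  next
    case False
    then have "msum (regular_module R) (\<lambda>U. LR_counit R (basis_elt R U)) (tree_mult S T) =
      msum (regular_module R) (\<lambda>U. \<zero>\<^bsub>regular_module R\<^esub>) (tree_mult S T)"
      using Leaf_in_tree_mult[of S T]
      by (intro K.M.msum_cong) (auto simp: LR_counit_basis regular_module_def)
    with False show ?thesis by (auto simp: LR_counit_basis) (simp_all add: regular_module_def)
  qed
  finally show "LR_counit R (LR_mult R (basis_elt R S) (basis_elt R T)) =
    LR_counit R (basis_elt R S) \<otimes> LR_counit R (basis_elt R T)" .
qed

lemma bialgebra_H_LR: "bialgebra R (H_LR R)"
  by (intro bialgebra.intro bialgebra_axioms.intro unital_algebra_H_LR)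
    (simp_all only: H_LR_simps(5-) LR_comult_hom LR_counit_hom LR_coassoc LR_counit_left LR_counit_right
      LR_comult_mult LR_counit_mult LR_comult_basis LR_counit_basis tree_comult.simps tree_pair_sum_single simp_thms if_True)

lemma cocycle_H_LR: "cocycle_condition R (H_LR R)"
proof -
  note H = module_H_LR and D = module_H_LR_tensor
  have "LR_comult R (LR_vee R x y) = tens R (H_LR R) (H_LR R) (LR_vee R x y) (basis_elt R Leaf) \<oplus>\<^bsub>tensor R (H_LR R) (H_LR R)\<^esub>
      op_pair R (H_LR R) (LR_mult R) (LR_vee R)
        (tens R (tensor R (H_LR R) (H_LR R)) (tensor R (H_LR R) (H_LR R)) (LR_comult R x) (LR_comult R y))"
    if "x \<in> carrier (H_LR R)" "y \<in> carrier (H_LR R)" for x y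
  proof (rule H_LR_bilinear_eqI[OF D module_hom_bilinear_map[OF LR_vee_bilinear LR_comult_hom] _ _ that])
    have left: "bilinear_map R (H_LR R) (H_LR R) (tensor R (H_LR R) (H_LR R))
        (\<lambda>x y. tens R (H_LR R) (H_LR R) (LR_vee R x y) (basis_elt R Leaf))"
      by (rule module_hom_bilinear_map[OF LR_vee_bilinear bilinear_map_left[OF tens_bilinear[OF H H]]]) simp
    note right = bilinear_map_compose[OF op_pair_bilinear[OF H LR_mult_bilinear LR_vee_bilinear] LR_comult_hom LR_comult_hom]
    show "bilinear_map R (H_LR R) (H_LR R) (tensor R (H_LR R) (H_LR R))
       (\<lambda>x y. tens R (H_LR R) (H_LR R) (LR_vee R x y) (basis_elt R Leaf) \<oplus>\<^bsub>tensor R (H_LR R) (H_LR R)\<^esub>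
         op_pair R (H_LR R) (LR_mult R) (LR_vee R)
        (tens R (tensor R (H_LR R) (H_LR R)) (tensor R (H_LR R) (H_LR R)) (LR_comult R x) (LR_comult R y)))"
      by (intro bilinear_mapI module_hom_plus[OF H D])
        (rule bilinear_map_left[OF left] bilinear_map_left[OF right] bilinear_map_right[OF left]
          bilinear_map_right[OF right]; assumption)+
  qed (simp only: LR_vee_basis LR_comult_basis tree_comult.simps tree_pair_sum_union tree_pair_sum_single op_pair_mult_vee)
  then show ?thesis
    unfolding cocycle_condition_def H_LR_simps(5-) by blast
qed

text \<open>The identity map corresponds to \<open>basis_elt R\<close>, whose value at
  \<open>Leaf\<close> is the unit, so it is invertible for convolution. The linear extension of the
  inverse is the antipode: on trees, the two antipode equations say that it is a left and a right
  inverse.\<close>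

lemma antipode_H_LR:
  obtains S where "is_antipode R (H_LR R) S"
proof -
  interpret H: unital_algebra R "H_LR R" by (rule unital_algebra_H_LR)
  note H = module_H_LR
  obtain L where L: "\<And>T. L T \<in> carrier (H_LR R)" "conv (H_LR R) L (basis_elt R) = conv_one (H_LR R)"
    "conv (H_LR R) (basis_elt R) L = conv_one (H_LR R)"
    by (rule H.conv_inverse[of "basis_elt R"]) auto
  define S where "S = lin_ext R (H_LR R) L"
  have S: "S \<in> module_hom R (H_LR R) (H_LR R)"
    unfolding S_def module_hom_H_LR(1) by (rule lin_ext_hom[OF H]) (use L in auto)
  have S_basis: "S (basis_elt R T) = L T" for T
    unfolding S_def by (rule lin_ext_basis[OF H]) (use L in auto)
  have mult: "bilinear_map R (H_LR R) (H_LR R) (H_LR R) (LR_mult R)" by (rule LR_mult_bilinear)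
  note lift = tensor_lift_hom[OF H H H mult]
  have unit: "(\<lambda>x. LR_counit R x \<odot>\<^bsub>H_LR R\<^esub> \<one>\<^bsub>H_LR R\<^esub>) \<in> module_hom R (H_LR R) (H_LR R)"
    by (rule bilinear_map_left[OF bilinear_map_counit(1)]) simp
  have unit_basis: "LR_counit R (basis_elt R T) \<odot>\<^bsub>H_LR R\<^esub> \<one>\<^bsub>H_LR R\<^esub> = conv_one (H_LR R) T" for T
    using H.smult_one[OF tree_closed] H.smult_l_null[OF tree_closed] by (simp add: LR_counit_basis conv_one_def)
  have "tensor_lift R (H_LR R) (LR_mult R) (tensor_map R (H_LR R) (H_LR R) S (\<lambda>y. y) (LR_comult R x)) =
      LR_counit R x \<odot>\<^bsub>H_LR R\<^esub> \<one>\<^bsub>H_LR R\<^esub>" if x: "x \<in> carrier (H_LR R)" for x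
  proof (rule H_LR_hom_eqI[OF H module_hom_compose[OF LR_comult_hom] unit _ x])
    note hom = module_hom_compose[OF tensor_map_hom[OF H H H H S module_hom_id] lift]
    show "(\<lambda>x. tensor_lift R (H_LR R) (LR_mult R) (tensor_map R (H_LR R) (H_LR R) S (\<lambda>y. y) x))
      \<in> module_hom R (tensor R (H_LR R) (H_LR R)) (H_LR R)"
      by (rule hom)
    fix T
    show "tensor_lift R (H_LR R) (LR_mult R) (tensor_map R (H_LR R) (H_LR R) S (\<lambda>y. y) (LR_comult R (basis_elt R T))) =
      LR_counit R (basis_elt R T) \<odot>\<^bsub>H_LR R\<^esub> \<one>\<^bsub>H_LR R\<^esub>"
      using fun_cong[OF L(2), of T] L(1)
      by (simp only: unit_basis LR_comult_basis tree_pair_sum_hom[OF H hom] tensor_map_tens[OF H H H H S module_hom_id]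
          tensor_lift_tens[OF H H H mult] tree_closed S_basis conv_def H_LR_simps(5))
  qed
  moreover have "tensor_lift R (H_LR R) (LR_mult R) (tensor_map R (H_LR R) (H_LR R) (\<lambda>y. y) S (LR_comult R x)) =
      LR_counit R x \<odot>\<^bsub>H_LR R\<^esub> \<one>\<^bsub>H_LR R\<^esub>" if x: "x \<in> carrier (H_LR R)" for x
  proof (rule H_LR_hom_eqI[OF H module_hom_compose[OF LR_comult_hom] unit _ x])
    note hom = module_hom_compose[OF tensor_map_hom[OF H H H H module_hom_id S] lift]
    show "(\<lambda>x. tensor_lift R (H_LR R) (LR_mult R) (tensor_map R (H_LR R) (H_LR R) (\<lambda>y. y) S x))
      \<in> module_hom R (tensor R (H_LR R) (H_LR R)) (H_LR R)"
      by (rule hom)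
    fix T
    show "tensor_lift R (H_LR R) (LR_mult R) (tensor_map R (H_LR R) (H_LR R) (\<lambda>y. y) S (LR_comult R (basis_elt R T))) =
      LR_counit R (basis_elt R T) \<odot>\<^bsub>H_LR R\<^esub> \<one>\<^bsub>H_LR R\<^esub>"
      using fun_cong[OF L(3), of T] L(1)
      by (simp only: unit_basis LR_comult_basis tree_pair_sum_hom[OF H hom] tensor_map_tens[OF H H H H module_hom_id S]
          tensor_lift_tens[OF H H H mult] tree_closed S_basis conv_def H_LR_simps(5))
  qed
  ultimately show ?thesis
    using that S unfolding is_antipode_def H_LR_simps(5,7,8) by blast
qed

lemma cocycle_vee_bialgebra_H_LR: "cocycle_vee_bialgebra R (H_LR R)"
  using bialgebra_H_LR vee_algebra_H_LR cocycle_H_LR by (simp add: cocycle_vee_bialgebra_def)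

lemma cocycle_vee_hopf_algebra_H_LR: "cocycle_vee_hopf_algebra R (H_LR R)"
  using bialgebra_H_LR vee_algebra_H_LR cocycle_H_LR antipode_H_LR
  by (auto simp: cocycle_vee_hopf_algebra_def intro!: hopf_algebra.intro hopf_algebra_axioms.intro)

end

section \<open>The universal property\<close>

lemma (in unital_algebra) mult_bilinear: "bilinear_map R A A A (monoid.mult A)"
  by (intro bilinear_mapI module_homI)
    (simp_all add: smult_mult_left smult_mult_right r_distr l_distr)

text \<open>With \<open>u\<close> the unit and \<open>v\<close> the grafting of a target, these are
  the only values on trees that a map preserving both can have.\<close>

primrec tree_eval :: "'a \<Rightarrow> ('a \<Rightarrow> 'a \<Rightarrow> 'a) \<Rightarrow> pbtree \<Rightarrow> 'a" where
  "tree_eval u v Leaf = u"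
| "tree_eval u v (Node l r) = v (tree_eval u v l) (tree_eval u v r)"

locale cocycle_vee_bialgebra_target =
  fixes R :: "('k, 'm) ring_scheme" (structure) and H :: "('k, 'h) vee_bialgebra"
  assumes cocycle_vee_bialgebra: "cocycle_vee_bialgebra R H"
begin

sublocale bialgebra R H
  using cocycle_vee_bialgebra by (simp add: cocycle_vee_bialgebra_def)

sublocale vee_algebra R H "vee H"
  using cocycle_vee_bialgebra by (simp add: cocycle_vee_bialgebra_def)

abbreviation ev :: "pbtree \<Rightarrow> 'h" where
  "ev \<equiv> tree_eval \<one>\<^bsub>H\<^esub> (vee H)"

lemmas H = module_axioms
lemma D: "module R (tensor R H H)"
  by (rule module_tensor[OF H H])

lemma vee_closed [simp]: "x \<in> carrier H \<Longrightarrow> y \<in> carrier H \<Longrightarrow> vee H x y \<in> carrier H"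
  by (rule bilinear_map_closed[OF vee_bilinear])

lemma ev_closed [simp]: "ev T \<in> carrier H"
  by (induction T) simp_all

lemma vee_msum: "vee H (msum H ev A) (msum H ev B) = msum H ev (A \<curlyvee> B)"
  by (rule bilinear_map_msum[OF H H H vee_bilinear]) simp_all

text \<open>The grafting law of the target expands the product of two evaluated nodes exactly as the
  recursion of \<open>tree_mult\<close> does.\<close>

lemma ev_mult: "ev S \<otimes>\<^bsub>H\<^esub> ev T = msum H ev (tree_mult S T)"
proof (induction S T rule: tree_mult.induct)
  case (3 l r l' r')
  have "ev (Node l r) \<otimes>\<^bsub>H\<^esub> ev (Node l' r') =
    vee H (ev l) (ev r \<otimes>\<^bsub>H\<^esub> ev (Node l' r')) \<oplus>\<^bsub>H\<^esub> vee H (ev (Node l r) \<otimes>\<^bsub>H\<^esub> ev l') (ev r')"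
    by (simp add: vee_mult)
  also have "\<dots> = msum H ev ({#l#} \<curlyvee> tree_mult r (Node l' r')) \<oplus>\<^bsub>H\<^esub> msum H ev (tree_mult (Node l r) l' \<curlyvee> {#r'#})"
    using 3 by (simp flip: vee_msum del: tree_eval.simps)
  finally show ?case by (simp only: tree_mult_Node_Node msum_union ev_closed)
qed simp_all

text \<open>The cocycle condition of the target is the recursion of \<open>tree_comult\<close> once
  \<open>ev_mult\<close> supplies the structure constants of the product.\<close>

lemma comult_ev: "comult H (ev T) = pair_sum R H ev (tree_comult T)"
proof (induction T)
  case Leaf
  show ?case by (simp add: comult_one pair_sum_single[OF H])
next
  case (Node l r)
  have "comult H (ev (Node l r)) = tens R H H (ev (Node l r)) \<one>\<^bsub>H\<^esub> \<oplus>\<^bsub>tensor R H H\<^esub>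
    op_pair R H (monoid.mult H) (vee H)
      (tens R (tensor R H H) (tensor R H H) (comult H (ev l)) (comult H (ev r)))"
    using cocycle_vee_bialgebra by (simp add: cocycle_vee_bialgebra_def cocycle_condition_def)
  also have "\<dots> = pair_sum R H ev {#(Node l r, Leaf)#} \<oplus>\<^bsub>tensor R H H\<^esub>
      pair_sum R H ev (tree_comult l \<curlyvee>\<^sub>2 tree_comult r)"
    by (simp add: Node pair_sum_single[OF H] ev_mult
        op_pair_pair_sum[OF H ev_closed mult_bilinear vee_bilinear, where f = tree_mult and f' = graft])
  finally show ?case by (simp only: tree_comult.simps pair_sum_union[OF H ev_closed])
qed

text \<open>
  The right counit axiom turns the cocycle condition into
  \<open>\<Sum> a\<^sub>1 b\<^sub>1 \<epsilon>(a\<^sub>2 \<or> b\<^sub>2) = 0\<close>.  Under \<open>\<epsilon>\<close> only the terms with trivial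
  left factor survive, by induction, and they add up to \<open>\<epsilon>(a \<or> b)\<close>.
\<close>

lemma counit_ev: "counit H (ev T) = (if T = Leaf then \<one> else \<zero>)"
proof (induction "size T" arbitrary: T rule: less_induct)
  case less
  show ?case
  proof (cases T)
    case Leaf then show ?thesis by (simp add: counit_one)
  next
    case (Node l r)
    let ?Q = "tree_comult l \<curlyvee>\<^sub>2 tree_comult r" and ?K = "regular_module R"
    interpret K: module R ?K by (rule module_regular_module)
    have counit_closed: "counit H x \<in> carrier R" if "x \<in> carrier H" for x
      using module_hom_closed[OF counit_linear that] by (simp add: regular_module_def)
    have \<beta>: "bilinear_map R H H H (\<lambda>a b. counit H b \<odot>\<^bsub>H\<^esub> a)"
      using bilinear_map_smult[OF H H counit_linear] by (auto simp: bilinear_map_def)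
    let ?g = "\<lambda>p. counit H (ev (snd p)) \<odot>\<^bsub>H\<^esub> ev (fst p)"
    have g: "?g p \<in> carrier H" for p by (simp add: counit_closed)
    have "ev T = tensor_lift R H (\<lambda>a b. counit H b \<odot>\<^bsub>H\<^esub> a) (comult H (ev T))"
      by (rule counit_right[symmetric]) simp
    also have "\<dots> = msum H ?g ({#(T, Leaf)#} + ?Q)"
      using module_hom_pair_sum[OF H ev_closed H tensor_lift_hom[OF H H H \<beta>]] tensor_lift_tens[OF H H H \<beta>]
      unfolding Node by (simp only: comult_ev ev_closed tree_comult.simps)
    \<comment> \<open>The leading pair contributes \<open>ev T\<close> itself, because its right
      factor evaluates to the unit; cancelling it shows that the remaining pairs sum to
      zero.\<close>
    also have "\<dots> = ev T \<oplus>\<^bsub>H\<^esub> msum H ?g ?Q"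
      by (subst msum_union[OF g]) (simp add: g counit_one)
    finally have "ev T \<oplus>\<^bsub>H\<^esub> msum H ?g ?Q = ev T" by simp
    then have "msum H ?g ?Q = \<zero>\<^bsub>H\<^esub>"
      by (simp add: M.add.r_cancel_one msum_closed g)
    then have "\<zero>\<^bsub>?K\<^esub> = counit H (msum H ?g ?Q)"
      using module_hom_zero[OF H module_regular_module counit_linear] by simp
    also have "\<dots> = msum ?K (\<lambda>p. counit H (?g p)) ?Q"
      by (rule module_hom_msum[OF H module_regular_module counit_linear g])
    also have "\<dots> = msum ?K (\<lambda>p. if fst p = Leaf then counit H (ev (snd p)) else \<zero>\<^bsub>?K\<^esub>) ?Q"
    proof (rule K.M.msum_cong)
      fix p assume p: "p \<in># ?Q"
      then have "snd p \<noteq> Leaf"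
        by (auto simp: in_mbind2_iff pair_op_def)
      moreover have "p \<in># tree_comult T" using p Node by simp
      ultimately have "size (fst p) < size T"
        using size_tree_comult[of p T] by (cases "snd p") auto
      then have "counit H (ev (fst p)) = (if fst p = Leaf then \<one> else \<zero>)"
        by (rule less)
      then show "counit H (?g p) = (if fst p = Leaf then counit H (ev (snd p)) else \<zero>\<^bsub>?K\<^esub>)"
        using module_hom_smult[OF counit_linear, of "counit H (ev (snd p))" "ev (fst p)"]
        by (auto simp: counit_closed regular_module_def)
    qed (auto simp: counit_closed regular_module_def)
    also have "\<dots> = msum ?K (\<lambda>p. counit H (ev (snd p))) (filter_mset (\<lambda>p. fst p = Leaf) ?Q)"
      by (rule K.M.msum_filter[symmetric]) (simp add: counit_closed regular_module_def)
    \<comment> \<open>The leading pair \<open>(T, Leaf)\<close> fails the test because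
      \<open>T\<close> is a node, so \<open>(Leaf, T)\<close> must come from
      \<open>?Q\<close>.\<close>
    also have "filter_mset (\<lambda>p. fst p = Leaf) ?Q = {#(Leaf, T)#}"
      using tree_counit_left[of T] Node by simp
    also have "msum ?K (\<lambda>p. counit H (ev (snd p))) {#(Leaf, T)#} = counit H (ev T)"
      using K.M.msum_single[of "\<lambda>p. counit H (ev (snd p))" "(Leaf, T)"] by (simp add: counit_closed regular_module_def)
    finally show ?thesis using Node by (simp add: regular_module_def)
  qed
qed

text \<open>The restriction makes the morphism extensional, as the uniqueness statement
  demands.\<close>

definition lift :: "(pbtree \<Rightarrow> 'k) \<Rightarrow> 'h" where
  "lift = restrict (lin_ext R H ev) (carrier (H_LR R))"

lemma lift_hom: "lift \<in> module_hom R (H_LR R) H"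
  by (rule module_hom_cong[OF module_H_LR, of "lin_ext R H ev"])
    (auto simp: lift_def module_hom_H_LR intro!: lin_ext_hom[OF H])

lemma lift_basis: "lift (basis_elt R T) = ev T"
  by (simp add: lift_def lin_ext_basis[OF H, of _ UNIV])

lemma lift_tree_sum: "lift (tree_sum A) = msum H ev A"
  by (simp add: module_hom_msum[OF module_H_LR H lift_hom] lift_basis)

lemma lift_vee_bialgebra_hom: "lift \<in> vee_bialgebra_hom R (H_LR R) H"
proof -
  note LR = module_H_LR
  note map = tensor_map_hom[OF LR LR H H lift_hom lift_hom]
  have "lift (LR_mult R x y) = lift x \<otimes>\<^bsub>H\<^esub> lift y"
    if "x \<in> carrier (H_LR R)" "y \<in> carrier (H_LR R)" for x y
    by (rule H_LR_bilinear_eqI[OF H module_hom_bilinear_map[OF LR_mult_bilinear lift_hom]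
        bilinear_map_compose[OF mult_bilinear lift_hom lift_hom] _ that])
      (simp add: LR_mult_basis lift_tree_sum lift_basis ev_mult)
  moreover have "lift (LR_vee R x y) = vee H (lift x) (lift y)"
    if "x \<in> carrier (H_LR R)" "y \<in> carrier (H_LR R)" for x y
    by (rule H_LR_bilinear_eqI[OF H module_hom_bilinear_map[OF LR_vee_bilinear lift_hom]
        bilinear_map_compose[OF vee_bilinear lift_hom lift_hom] _ that])
      (simp add: lift_basis)
  moreover have "comult H (lift x) = tensor_map R H H lift lift (LR_comult R x)"
    if "x \<in> carrier (H_LR R)" for x
    by (rule H_LR_hom_eqI[OF D module_hom_compose[OF lift_hom comult_linear]
        module_hom_compose[OF LR_comult_hom map] _ that])
      (simp add: lift_basis comult_ev LR_comult_basis tree_pair_sum_hom[OF D map]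
        tensor_map_tens[OF LR LR H H lift_hom lift_hom] flip: pair_sum_def)
  moreover have "counit H (lift x) = LR_counit R x"
    if "x \<in> carrier (H_LR R)" for x
    by (rule H_LR_hom_eqI[OF module_regular_module module_hom_compose[OF lift_hom counit_linear]
        LR_counit_hom _ that])
      (simp add: lift_basis counit_ev LR_counit_basis)
  ultimately show ?thesis
    using lift_hom lift_basis[of Leaf] by (simp add: vee_bialgebra_hom_def bialgebra_hom_def)
qed

text \<open>Compatibility with unit and grafting fixes the values on trees, linearity fixes those on
  the carrier, and extensionality settles the rest.\<close>

lemma vee_bialgebra_hom_unique:
  assumes "\<phi> \<in> vee_bialgebra_hom R (H_LR R) H" "\<phi> \<in> extensional (carrier (H_LR R))"
  shows "\<phi> = lift"
proof (rule extensionalityI[OF assms(2)])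
  show "lift \<in> extensional (carrier (H_LR R))" by (simp add: lift_def)
  have hom: "\<phi> \<in> module_hom R (H_LR R) H" and one: "\<phi> (basis_elt R Leaf) = \<one>\<^bsub>H\<^esub>"
    using assms(1) by (auto simp: vee_bialgebra_hom_def bialgebra_hom_def)
  have vee: "\<phi> (basis_elt R (Node l r)) = vee H (\<phi> (basis_elt R l)) (\<phi> (basis_elt R r))" for l r
  proof -
    have "\<phi> (LR_vee R (basis_elt R l) (basis_elt R r)) = vee H (\<phi> (basis_elt R l)) (\<phi> (basis_elt R r))"
      using assms(1) tree_closed[of l] tree_closed[of r] unfolding vee_bialgebra_hom_def H_LR_simps by blast
    then show ?thesis by simp
  qed
  have basis: "\<phi> (basis_elt R T) = ev T" for T
    by (induction T) (simp_all add: one vee)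
  show "\<phi> x = lift x" if "x \<in> carrier (H_LR R)" for x
    by (rule H_LR_hom_eqI[OF H hom lift_hom _ that]) (simp add: lift_basis basis)
qed

lemma ex1_vee_bialgebra_hom:
  "\<exists>!\<phi>. \<phi> \<in> extensional (carrier (H_LR R)) \<and> \<phi> \<in> vee_bialgebra_hom R (H_LR R) H"
proof (rule ex1I[of _ lift])
  have "lift \<in> extensional (carrier (H_LR R))" by (simp add: lift_def)
  then show "lift \<in> extensional (carrier (H_LR R)) \<and> lift \<in> vee_bialgebra_hom R (H_LR R) H"
    using lift_vee_bialgebra_hom by blast
qed (use vee_bialgebra_hom_unique in blast)

text \<open>
  Both \<open>\<phi> \<circ> S\<close> and \<open>S' \<circ> \<phi>\<close> are convolution inverses of \<open>\<phi>\<close>.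
\<close>

lemma bialgebra_hom_antipode:
  assumes \<phi>: "\<phi> \<in> bialgebra_hom R (H_LR R) H"
    and S: "is_antipode R (H_LR R) S" and S': "is_antipode R H S'" and x: "x \<in> carrier (H_LR R)"
  shows "\<phi> (S x) = S' (\<phi> x)"
proof -
  note LR = module_H_LR
  have \<phi>_hom: "\<phi> \<in> module_hom R (H_LR R) H" and S_hom: "S \<in> module_hom R (H_LR R) (H_LR R)"
    and S'_hom: "S' \<in> module_hom R H H"
    using assms by (auto simp: bialgebra_hom_def is_antipode_def)
  note closed = module_hom_closed[OF \<phi>_hom] module_hom_closed[OF S_hom] module_hom_closed[OF S'_hom]
  have \<phi>_mult: "\<phi> (LR_mult R x y) = \<phi> x \<otimes>\<^bsub>H\<^esub> \<phi> y"
    if "x \<in> carrier (H_LR R)" "y \<in> carrier (H_LR R)" for x y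
    using \<phi> that by (auto simp: bialgebra_hom_def)
  let ?e = "basis_elt R :: pbtree \<Rightarrow> _"
  note mult = tensor_lift_hom[OF LR LR LR LR_mult_bilinear] tensor_lift_hom[OF H H H mult_bilinear]
  have e: "?e T \<in> carrier (H_LR R)" for T by simp
  \<comment> \<open>This is the image under \<open>\<phi>\<close> of the antipode equation of
    \<open>H_LR R\<close> at a tree.\<close>
  have left: "conv H (\<lambda>T. \<phi> (S (?e T))) (\<lambda>T. \<phi> (?e T)) T = conv_one H T" for T
  proof -
    note hom = module_hom_compose[OF module_hom_compose[OF tensor_map_hom[OF LR LR LR LR S_hom module_hom_id] mult(1)] \<phi>_hom]
    have "\<phi> (tensor_lift R (H_LR R) (LR_mult R) (tensor_map R (H_LR R) (H_LR R) S (\<lambda>y. y) (LR_comult R (?e T)))) =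
      conv H (\<lambda>T. \<phi> (S (?e T))) (\<lambda>T. \<phi> (?e T)) T"
      by (simp only: LR_comult_basis tree_pair_sum_hom[OF H hom] tensor_map_tens[OF LR LR LR LR S_hom module_hom_id]
          tensor_lift_tens[OF LR LR LR LR_mult_bilinear] e closed \<phi>_mult conv_def)
    moreover have "tensor_lift R (H_LR R) (LR_mult R) (tensor_map R (H_LR R) (H_LR R) S (\<lambda>y. y) (LR_comult R (?e T))) =
      LR_counit R (?e T) \<odot>\<^bsub>H_LR R\<^esub> ?e Leaf"
      using S e[of T] unfolding is_antipode_def H_LR_simps(5-8) by blast
    moreover have "\<phi> (LR_counit R (?e T) \<odot>\<^bsub>H_LR R\<^esub> ?e Leaf) = conv_one H T"
      using \<phi> module_hom_smult[OF \<phi>_hom, of "LR_counit R (?e T)" "?e Leaf"]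
      by (auto simp: LR_counit_basis conv_one_def bialgebra_hom_def)
    ultimately show ?thesis by simp
  qed
  \<comment> \<open>This is the antipode equation of \<open>H\<close> at the image of a tree, with
    the coproduct and counit there rewritten through \<open>\<phi>\<close>.\<close>
  have right: "conv H (\<lambda>T. \<phi> (?e T)) (\<lambda>T. S' (\<phi> (?e T))) T = conv_one H T" for T
  proof -
    note hom = module_hom_compose[OF tensor_map_hom[OF LR LR H H \<phi>_hom \<phi>_hom]
        module_hom_compose[OF tensor_map_hom[OF H H H H module_hom_id S'_hom] mult(2)]]
    have comult: "comult H (\<phi> (?e T)) = tensor_map R H H \<phi> \<phi> (LR_comult R (?e T))"
      and counit: "counit H (\<phi> (?e T)) = LR_counit R (?e T)"
      using \<phi> by (auto simp: bialgebra_hom_def)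
    have "tensor_lift R H (monoid.mult H) (tensor_map R H H (\<lambda>y. y) S' (comult H (\<phi> (?e T)))) =
      conv H (\<lambda>T. \<phi> (?e T)) (\<lambda>T. S' (\<phi> (?e T))) T"
      by (simp only: comult LR_comult_basis tree_pair_sum_hom[OF H hom] tensor_map_tens[OF LR LR H H \<phi>_hom \<phi>_hom]
          tensor_map_tens[OF H H H H module_hom_id S'_hom]
          tensor_lift_tens[OF H H H mult_bilinear] e closed conv_def)
    moreover have "tensor_lift R H (monoid.mult H) (tensor_map R H H (\<lambda>y. y) S' (comult H (\<phi> (?e T)))) =
      counit H (\<phi> (?e T)) \<odot>\<^bsub>H\<^esub> \<one>\<^bsub>H\<^esub>"
      using S' closed(1)[OF e[of T]] unfolding is_antipode_def by blast
    moreover have "counit H (\<phi> (?e T)) \<odot>\<^bsub>H\<^esub> \<one>\<^bsub>H\<^esub> = conv_one H T"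
      by (simp add: counit LR_counit_basis conv_one_def)
    ultimately show ?thesis by simp
  qed
  have "(\<lambda>T. \<phi> (S (?e T))) = (\<lambda>T. S' (\<phi> (?e T)))"
    by (rule conv_inverse_unique[OF _ _ _ ext[OF left] ext[OF right]]; intro closed e)
  from fun_cong[OF this] show ?thesis
    by (rule H_LR_hom_eqI[OF H module_hom_compose[OF S_hom \<phi>_hom] module_hom_compose[OF \<phi>_hom S'_hom] _ x])
qed

text \<open>Compatibility with antipodes is automatic, so unique existence of Hopf morphisms follows
  from that of bialgebra morphisms.\<close>

lemma vee_hopf_algebra_hom_eq: "vee_hopf_algebra_hom R (H_LR R) H = vee_bialgebra_hom R (H_LR R) H"
  unfolding vee_hopf_algebra_hom_def vee_bialgebra_hom_def hopf_algebra_hom_def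
  using bialgebra_hom_antipode by blast

end

lemma cocycle_vee_hopf_algebra_imp_bialgebra:
  "cocycle_vee_hopf_algebra R H \<Longrightarrow> cocycle_vee_bialgebra R H"
  by (auto simp: cocycle_vee_hopf_algebra_def cocycle_vee_bialgebra_def hopf_algebra_def)

theorem corollary3p11:
  fixes R :: "('k, 'm) ring_scheme" and j :: "'x \<Rightarrow> (pbtree \<Rightarrow> 'k)"
  assumes "cring R"
  shows
    "(free_cocycle_vee_bialgebra TYPE('h) R {} j (H_LR R) \<and>
      initial_cocycle_vee_bialgebra TYPE('h) R (H_LR R)) \<and>
     (free_cocycle_vee_hopf_algebra TYPE('h) R {} j (H_LR R) \<and>
      initial_cocycle_vee_hopf_algebra TYPE('h) R (H_LR R))"
proof -
  have bialgebra: "\<exists>!\<phi>. \<phi> \<in> extensional (carrier (H_LR R)) \<and> \<phi> \<in> vee_bialgebra_hom R (H_LR R) H'"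
    if "cocycle_vee_bialgebra R H'" for H' :: "('k, 'h) vee_bialgebra"
    using cocycle_vee_bialgebra_target.ex1_vee_bialgebra_hom[OF cocycle_vee_bialgebra_target.intro[OF that]] .
  have hopf: "\<exists>!\<phi>. \<phi> \<in> extensional (carrier (H_LR R)) \<and> \<phi> \<in> vee_hopf_algebra_hom R (H_LR R) H'"
    if "cocycle_vee_hopf_algebra R H'" for H' :: "('k, 'h) vee_bialgebra"
  proof -
    note H' = cocycle_vee_hopf_algebra_imp_bialgebra[OF that]
    show ?thesis
      unfolding cocycle_vee_bialgebra_target.vee_hopf_algebra_hom_eq[OF cocycle_vee_bialgebra_target.intro[OF H']]
      by (rule bialgebra[OF H'])
  qed
  \<comment> \<open>Over the empty set the conditions on \<open>j\<close> and on the set map into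
    the target are vacuous, so freeness and initiality unfold to the same two facts.\<close>
  show ?thesis
    using bialgebra hopf cring.cocycle_vee_bialgebra_H_LR[OF assms] cring.cocycle_vee_hopf_algebra_H_LR[OF assms]
    by (simp add: free_cocycle_vee_bialgebra_def initial_cocycle_vee_bialgebra_def
        free_cocycle_vee_hopf_algebra_def initial_cocycle_vee_hopf_algebra_def)
qed

end
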